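(* Let $(E,(p_\alpha)_{\alpha\in\Lambda})$ be a complete uniform topological algebra, with factors $E_\alpha=E/\ker(p_\alpha)$. Then there is an algebra isomorphism $\varphi: M(E)\to\varprojlim M(E_\alpha)$. Furthermore, if each factor $E_\alpha$ $(\alpha\in\Lambda)$ is complete, then every multiplier of $E$ is continuous and $\varphi$ is a topological algebra isomorphism, where $M(E)$ is endowed with its seminorm topology.
   Context: All algebras are over $\mathbb{C}$ (not assumed unital). A topological algebra is an algebra that is also a Hausdorff topological vector space with separately continuous multiplication. Seminorms on algebras are assumed submultiplicative: $p(xy)\le p(x)p(y)$. A uniform seminorm is a seminorm $p$ with $p(x^2)=p(x)^2$ for all $x$. A uniform topological algebra $(E,(p_\alpha)_{\alpha\in\Lambda})$ is a topological algebra whose topology is determined by a directed family $(p_\alpha)_{\alpha\in\Lambda}$ of uniform seminorms; $\Lambda$ is ordered by $\alpha\le\beta$ iff $p_\alpha(x)\le p_\beta(x)$ for all $x\in E$. Factors: $E_\alpha=E/\ker(p_\alpha)$, where $\ker(p_\alpha)=\{x: p_\alpha(x)=0\}$, is a normed algebra with norm $\overline{p}_\alpha(x+\ker(p_\alpha))=p_\alpha(x)$; $f_\alpha:E\to E_\alpha$ is the quotient map; for $\alpha\le\beta$, $f_{\alpha\beta}:E_\beta\to E_\alpha$ is the homomorphism $x+\ker(p_\beta)\mapsto x+\ker(p_\alpha)$. Multipliers: a multiplier of an algebra $A$ is a map $T:A\to A$ with $T(x)y=xT(y)$ for all $x,y\in A$; $M(A)$ is the set of all multipliers of $A$. An algebra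 $A$ is proper if $xA=Ax=\{0\}$ implies $x=0$; uniform topological algebras and uniform normed algebras are proper. For proper $A$, multipliers are linear, satisfy $T(xy)=T(x)y=xT(y)$, and $M(A)$ is a commutative unital algebra under pointwise addition and scalar multiplication, and composition. Projective limit: for $\alpha\le\beta$ and $U\in M(E_\beta)$, $h_{\alpha\beta}(U)$ denotes the unique element of $M(E_\alpha)$ with $h_{\alpha\beta}(U)\circ f_{\alpha\beta}=f_{\alpha\beta}\circ U$ (it exists in this setting, and $(M(E_\alpha),h_{\alpha\beta})$ is a projective system of algebras). $\varprojlim M(E_\alpha)=\{(U_\alpha)_\alpha\in\prod_\alpha M(E_\alpha): h_{\alpha\beta}(U_\beta)=U_\alpha \text{ for all }\alpha\le\beta\}$. Topologies (when all $E_\alpha$ are complete, so that all multipliers of $E_\alpha$ are continuous): $M(E_\alpha)$ carries the operator norm $\|U\|_\alpha=\sup\{\overline{p}_\alpha(U(z)): z\in E_\alpha,\ \overline{p}_\alpha(z)\le1\}$, and $\varprojlim M(E_\alpha)$ carries the projective limit topology. For $T\in M(E)$, $T_\alpha$ denotes the unique element of $M(E_\alpha)$ with $f_\alpha\circ T=T_\alpha\circ f_\alpha$ (it exists in this setting). The seminorm topology on $M(E)$ is the one defined by the seminorms $q_\alpha(T)=\|T_\alpha\|_\alpha$, $\alpha\in\Lambda$. *)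

theory Defs
  imports "HOL-Analysis.Analysis" "HOL-Algebra.QuotRing" "HOL-Algebra.Algebraic_Closure_Type"
begin

section \<open>Complex algebras\<close>

text \<open>
  Algebras over the complex numbers are neither unital nor commutative in general, so the locale
  \<open>algebra\<close> of \<open>HOL-Algebra\<close> is too strong. Only its record type is used here. The field
  \<^const>\<open>one\<close> of that record carries no meaning in a \<open>complex_algebra\<close>: no axiom mentions it.
\<close>

locale complex_algebra =
  Module.module "ring_of_type_algebra :: complex ring" A
  for A :: "(complex, 'a) module" (structure) +
  assumes mult_closed: "\<lbrakk>x \<in> carrier A; y \<in> carrier A\<rbrakk> \<Longrightarrow> x \<otimes> y \<in> carrier A"
    and mult_assoc: "\<lbrakk>x \<in> carrier A; y \<in> carrier A; z \<in> carrier A\<rbrakk>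
      \<Longrightarrow> (x \<otimes> y) \<otimes> z = x \<otimes> (y \<otimes> z)"
    and mult_add_left: "\<lbrakk>x \<in> carrier A; y \<in> carrier A; z \<in> carrier A\<rbrakk>
      \<Longrightarrow> (x \<oplus> y) \<otimes> z = x \<otimes> z \<oplus> y \<otimes> z"
    and mult_add_right: "\<lbrakk>x \<in> carrier A; y \<in> carrier A; z \<in> carrier A\<rbrakk>
      \<Longrightarrow> z \<otimes> (x \<oplus> y) = z \<otimes> x \<oplus> z \<otimes> y"
    and mult_smult_left: "\<lbrakk>x \<in> carrier A; y \<in> carrier A\<rbrakk> \<Longrightarrow> (c \<odot> x) \<otimes> y = c \<odot> (x \<otimes> y)"
    and mult_smult_right: "\<lbrakk>x \<in> carrier A; y \<in> carrier A\<rbrakk> \<Longrightarrow> x \<otimes> (c \<odot> y) = c \<odot> (x \<otimes> y)"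

definition algebra_iso :: "(complex, 'a) module \<Rightarrow> (complex, 'b) module \<Rightarrow> ('a \<Rightarrow> 'b) set" where
  "algebra_iso A B = {f. bij_betw f (carrier A) (carrier B) \<and>
     (\<forall>x\<in>carrier A. \<forall>y\<in>carrier A.
        f (x \<oplus>\<^bsub>A\<^esub> y) = f x \<oplus>\<^bsub>B\<^esub> f y \<and> f (x \<otimes>\<^bsub>A\<^esub> y) = f x \<otimes>\<^bsub>B\<^esub> f y) \<and>
     (\<forall>c. \<forall>x\<in>carrier A. f (c \<odot>\<^bsub>A\<^esub> x) = c \<odot>\<^bsub>B\<^esub> f x)}"

text \<open>The library quotient \<open>A Quot I\<close>, which has no scalars, with \<open>c \<odot> (x + I) = c \<odot> x + I\<close> added.\<close>

definition quotient_algebra :: "(complex, 'a) module \<Rightarrow> 'a set \<Rightarrow> (complex, 'a set) module" where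
  "quotient_algebra A I =
     \<lparr>carrier = carrier (A Quot I), mult = mult (A Quot I), one = one (A Quot I),
      zero = zero (A Quot I), add = add (A Quot I),
      smult = (\<lambda>c C. \<Union>x\<in>C. I +>\<^bsub>A\<^esub> (c \<odot>\<^bsub>A\<^esub> x))\<rparr>"

section \<open>Topological algebras\<close>

locale topological_algebra = complex_algebra A
  for A :: "(complex, 'a) module" (structure) and \<tau> :: "'a topology" +
  assumes topspace_eq: "topspace \<tau> = carrier A"
    and Hausdorff: "Hausdorff_space \<tau>"
    and continuous_add: "continuous_map (prod_topology \<tau> \<tau>) \<tau> (\<lambda>(x, y). x \<oplus> y)"
    and continuous_smult:
      "continuous_map (prod_topology (euclidean :: complex topology) \<tau>) \<tau> (\<lambda>(c, x). c \<odot> x)"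
    and continuous_mult_left: "a \<in> carrier A \<Longrightarrow> continuous_map \<tau> \<tau> (\<lambda>x. a \<otimes> x)"
    and continuous_mult_right: "a \<in> carrier A \<Longrightarrow> continuous_map \<tau> \<tau> (\<lambda>x. x \<otimes> a)"

text \<open>
  Completeness with respect to the canonical uniformity of the additive topological group: every
  proper Cauchy filter on the carrier converges.
\<close>

definition complete_algebra :: "(complex, 'a) module \<Rightarrow> 'a topology \<Rightarrow> bool" where
  "complete_algebra A \<tau> \<longleftrightarrow>
     (\<forall>F. F \<noteq> bot \<and> F \<le> principal (carrier A) \<and>
        (\<forall>U. openin \<tau> U \<and> \<zero>\<^bsub>A\<^esub> \<in> U \<longrightarrow> (\<forall>\<^sub>F (x, y) in F \<times>\<^sub>F F. x \<ominus>\<^bsub>A\<^esub> y \<in> U))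
        \<longrightarrow> (\<exists>l. limitin \<tau> (\<lambda>x. x) l F))"

section \<open>Uniform seminorms and their factors\<close>

definition algebra_seminorm :: "(complex, 'a) module \<Rightarrow> ('a \<Rightarrow> real) \<Rightarrow> bool" where
  "algebra_seminorm A p \<longleftrightarrow>
     (\<forall>x\<in>carrier A. 0 \<le> p x) \<and>
     (\<forall>c. \<forall>x\<in>carrier A. p (c \<odot>\<^bsub>A\<^esub> x) = cmod c * p x) \<and>
     (\<forall>x\<in>carrier A. \<forall>y\<in>carrier A. p (x \<oplus>\<^bsub>A\<^esub> y) \<le> p x + p y) \<and>
     (\<forall>x\<in>carrier A. \<forall>y\<in>carrier A. p (x \<otimes>\<^bsub>A\<^esub> y) \<le> p x * p y)"

definition uniform_seminorm :: "(complex, 'a) module \<Rightarrow> ('a \<Rightarrow> real) \<Rightarrow> bool" where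
  "uniform_seminorm A p \<longleftrightarrow> algebra_seminorm A p \<and> (\<forall>x\<in>carrier A. p (x \<otimes>\<^bsub>A\<^esub> x) = (p x)\<^sup>2)"

definition seminorm_le :: "(complex, 'a) module \<Rightarrow> ('a \<Rightarrow> real) \<Rightarrow> ('a \<Rightarrow> real) \<Rightarrow> bool" where
  "seminorm_le A p q \<longleftrightarrow> (\<forall>x\<in>carrier A. p x \<le> q x)"

text \<open>For a singleton \<open>P = {q}\<close> with \<open>q\<close> a norm this is the norm topology.\<close>

definition seminorm_topology :: "(complex, 'a) module \<Rightarrow> ('a \<Rightarrow> real) set \<Rightarrow> 'a topology" where
  "seminorm_topology A P =
     topology_generated_by
       {{y \<in> carrier A. q (y \<ominus>\<^bsub>A\<^esub> x) < e} | q x e. q \<in> P \<and> x \<in> carrier A \<and> 0 < e}"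

locale uniform_topological_algebra = topological_algebra A \<tau>
  for A :: "(complex, 'a) module" (structure) and \<tau> :: "'a topology" +
  fixes \<Lambda> :: "'i set" and p :: "'i \<Rightarrow> 'a \<Rightarrow> real"
  assumes uniform: "\<alpha> \<in> \<Lambda> \<Longrightarrow> uniform_seminorm A (p \<alpha>)"
    and nonempty: "\<Lambda> \<noteq> {}"
    and directed: "\<lbrakk>\<alpha> \<in> \<Lambda>; \<beta> \<in> \<Lambda>\<rbrakk>
      \<Longrightarrow> \<exists>\<gamma>\<in>\<Lambda>. seminorm_le A (p \<alpha>) (p \<gamma>) \<and> seminorm_le A (p \<beta>) (p \<gamma>)"
    and topology_eq: "\<tau> = seminorm_topology A (p ` \<Lambda>)"

definition seminorm_kernel :: "(complex, 'a) module \<Rightarrow> ('a \<Rightarrow> real) \<Rightarrow> 'a set" where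
  "seminorm_kernel A p = {x \<in> carrier A. p x = 0}"

definition factor_algebra :: "(complex, 'a) module \<Rightarrow> ('a \<Rightarrow> real) \<Rightarrow> (complex, 'a set) module" where
  "factor_algebra A p = quotient_algebra A (seminorm_kernel A p)"

text \<open>A seminorm is constant on each coset of its kernel, so \<open>p ` C\<close> below is a singleton.\<close>

definition factor_norm :: "('a \<Rightarrow> real) \<Rightarrow> 'a set \<Rightarrow> real" where
  "factor_norm p C = the_elem (p ` C)"

definition factor_proj :: "(complex, 'a) module \<Rightarrow> ('a \<Rightarrow> real) \<Rightarrow> 'a \<Rightarrow> 'a set" where
  "factor_proj A p x = seminorm_kernel A p +>\<^bsub>A\<^esub> x"

text \<open>
  The map \<open>x + ker q \<mapsto> x + ker p\<close> from \<open>factor_algebra A q\<close> to \<open>factor_algebra A p\<close>, for \<open>seminorm_le A p q\<close>;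
  then all \<open>x\<close> in a coset of \<open>ker q\<close> have the same image, so the union is a single coset.
\<close>

definition factor_map ::
  "(complex, 'a) module \<Rightarrow> ('a \<Rightarrow> real) \<Rightarrow> ('a \<Rightarrow> real) \<Rightarrow> 'a set \<Rightarrow> 'a set" where
  "factor_map A p q C = (\<Union>x\<in>C. factor_proj A p x)"

section \<open>Multipliers\<close>

text \<open>
  Maps from the carrier to itself are represented by extensional functions, so that equality of
  multipliers is equality on the carrier.
\<close>

definition multipliers :: "(complex, 'a) module \<Rightarrow> ('a \<Rightarrow> 'a) set" where
  "multipliers A = {T \<in> carrier A \<rightarrow>\<^sub>E carrier A.
     \<forall>x\<in>carrier A. \<forall>y\<in>carrier A. T x \<otimes>\<^bsub>A\<^esub> y = x \<otimes>\<^bsub>A\<^esub> T y}"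

definition multiplier_algebra :: "(complex, 'a) module \<Rightarrow> (complex, 'a \<Rightarrow> 'a) module" where
  "multiplier_algebra A =
     \<lparr>carrier = multipliers A,
      mult = (\<lambda>S T. compose (carrier A) S T),
      one = (\<lambda>x\<in>carrier A. x),
      zero = (\<lambda>x\<in>carrier A. \<zero>\<^bsub>A\<^esub>),
      add = (\<lambda>S T. \<lambda>x\<in>carrier A. S x \<oplus>\<^bsub>A\<^esub> T x),
      smult = (\<lambda>c T. \<lambda>x\<in>carrier A. c \<odot>\<^bsub>A\<^esub> T x)\<rparr>"

text \<open>
  The unique multiplier \<open>V\<close> of \<open>B\<close> with \<open>V \<circ> f = f \<circ> U\<close>, for \<open>f\<close> from \<open>A\<close> to \<open>B\<close> and a
  multiplier \<open>U\<close> of \<open>A\<close>. For \<open>f\<close> the projection onto a factor this is \<open>T\<^sub>\<alpha>\<close>; for \<open>f\<close> the map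
  between two factors it is \<open>h\<^sub>\<alpha>\<^sub>\<beta> U\<close>.
\<close>

definition induced_multiplier ::
  "(complex, 'a) module \<Rightarrow> (complex, 'b) module \<Rightarrow> ('a \<Rightarrow> 'b) \<Rightarrow> ('a \<Rightarrow> 'a) \<Rightarrow> 'b \<Rightarrow> 'b" where
  "induced_multiplier A B f U =
     (THE V. V \<in> multipliers B \<and> (\<forall>x\<in>carrier A. V (f x) = f (U x)))"

definition factor_multiplier ::
  "(complex, 'a) module \<Rightarrow> ('a \<Rightarrow> real) \<Rightarrow> ('a \<Rightarrow> 'a) \<Rightarrow> 'a set \<Rightarrow> 'a set" where
  "factor_multiplier A p T = induced_multiplier A (factor_algebra A p) (factor_proj A p) T"

definition connecting_map ::
  "(complex, 'a) module \<Rightarrow> ('a \<Rightarrow> real) \<Rightarrow> ('a \<Rightarrow> real) \<Rightarrow> ('a set \<Rightarrow> 'a set) \<Rightarrow> 'a set \<Rightarrow> 'a set" where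
  "connecting_map A p q U = induced_multiplier (factor_algebra A q) (factor_algebra A p) (factor_map A p q) U"

section \<open>The projective limit of the multiplier algebras of the factors\<close>

definition projective_limit ::
  "'i set \<Rightarrow> ('i \<Rightarrow> 'i \<Rightarrow> bool) \<Rightarrow> ('i \<Rightarrow> (complex, 'b) module) \<Rightarrow> ('i \<Rightarrow> 'i \<Rightarrow> 'b \<Rightarrow> 'b)
     \<Rightarrow> (complex, 'i \<Rightarrow> 'b) module" where
  "projective_limit \<Lambda> below B h =
     \<lparr>carrier = {u \<in> (\<Pi>\<^sub>E \<alpha>\<in>\<Lambda>. carrier (B \<alpha>)).
        \<forall>\<alpha>\<in>\<Lambda>. \<forall>\<beta>\<in>\<Lambda>. below \<alpha> \<beta> \<longrightarrow> h \<alpha> \<beta> (u \<beta>) = u \<alpha>},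
      mult = (\<lambda>u v. \<lambda>\<alpha>\<in>\<Lambda>. u \<alpha> \<otimes>\<^bsub>B \<alpha>\<^esub> v \<alpha>),
      one = (\<lambda>\<alpha>\<in>\<Lambda>. \<one>\<^bsub>B \<alpha>\<^esub>),
      zero = (\<lambda>\<alpha>\<in>\<Lambda>. \<zero>\<^bsub>B \<alpha>\<^esub>),
      add = (\<lambda>u v. \<lambda>\<alpha>\<in>\<Lambda>. u \<alpha> \<oplus>\<^bsub>B \<alpha>\<^esub> v \<alpha>),
      smult = (\<lambda>c u. \<lambda>\<alpha>\<in>\<Lambda>. c \<odot>\<^bsub>B \<alpha>\<^esub> u \<alpha>)\<rparr>"

definition limit_multiplier_algebra ::
  "(complex, 'a) module \<Rightarrow> 'i set \<Rightarrow> ('i \<Rightarrow> 'a \<Rightarrow> real)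
     \<Rightarrow> (complex, 'i \<Rightarrow> 'a set \<Rightarrow> 'a set) module" where
  "limit_multiplier_algebra A \<Lambda> p =
     projective_limit \<Lambda> (\<lambda>\<alpha> \<beta>. seminorm_le A (p \<alpha>) (p \<beta>))
       (\<lambda>\<alpha>. multiplier_algebra (factor_algebra A (p \<alpha>))) (\<lambda>\<alpha> \<beta>. connecting_map A (p \<alpha>) (p \<beta>))"

section \<open>Topologies on multiplier algebras\<close>

text \<open>
  The supremum is a real one. It is meaningful when the multipliers of \<open>factor_algebra A p\<close> are
  continuous, in particular when \<open>factor_algebra A p\<close> is complete.
\<close>

definition factor_opnorm ::
  "(complex, 'a) module \<Rightarrow> ('a \<Rightarrow> real) \<Rightarrow> ('a set \<Rightarrow> 'a set) \<Rightarrow> real" where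
  "factor_opnorm A p U =
     Sup {factor_norm p (U z) | z. z \<in> carrier (factor_algebra A p) \<and> factor_norm p z \<le> 1}"

definition multiplier_seminorm ::
  "(complex, 'a) module \<Rightarrow> ('a \<Rightarrow> real) \<Rightarrow> ('a \<Rightarrow> 'a) \<Rightarrow> real" where
  "multiplier_seminorm A p T = factor_opnorm A p (factor_multiplier A p T)"

definition multiplier_topology ::
  "(complex, 'a) module \<Rightarrow> 'i set \<Rightarrow> ('i \<Rightarrow> 'a \<Rightarrow> real) \<Rightarrow> ('a \<Rightarrow> 'a) topology" where
  "multiplier_topology A \<Lambda> p =
     seminorm_topology (multiplier_algebra A) ((\<lambda>\<alpha>. multiplier_seminorm A (p \<alpha>)) ` \<Lambda>)"

definition limit_multiplier_topology ::
  "(complex, 'a) module \<Rightarrow> 'i set \<Rightarrow> ('i \<Rightarrow> 'a \<Rightarrow> real)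
     \<Rightarrow> ('i \<Rightarrow> 'a set \<Rightarrow> 'a set) topology" where
  "limit_multiplier_topology A \<Lambda> p =
     subtopology
       (product_topology
          (\<lambda>\<alpha>. seminorm_topology (multiplier_algebra (factor_algebra A (p \<alpha>))) {factor_opnorm A (p \<alpha>)}) \<Lambda>)
       (carrier (limit_multiplier_algebra A \<Lambda> p))"

end

theory Submission
  imports Defs
begin

text \<open>
  In an algebra without nonzero elements of square zero, \<open>T x \<cdot> y = x \<cdot> T y\<close> forces \<open>T\<close> to be linear, and
  every homomorphism onto such an algebra transports multipliers: if \<open>f x = f y\<close> and \<open>w = U x - U y\<close>,
  then \<open>w\<^sup>2 = (x - y) \<cdot> U w\<close>, so \<open>f w\<close> has square zero. Factors of uniform seminorms are of this kind,
  hence \<open>T \<mapsto> (T\<^sub>\<alpha>)\<close> is a well-defined homomorphism, injective because \<open>E\<close> is Hausdorff. Given a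
  compatible family \<open>(U\<^sub>\<alpha>)\<close> and a point \<open>x\<close>, the cosets \<open>U\<^sub>\<alpha> (x + ker p\<^sub>\<alpha>)\<close>, viewed as subsets of \<open>E\<close>,
  are a Cauchy filter base, and its limit is the value at \<open>x\<close> of the multiplier inducing the family.

  If a factor is complete, a multiplier \<open>U\<close> of it is bounded: were it not, the sets
  \<open>{x. n < \<parallel>U x\<parallel>}\<close> would be dense, and they are open since
  \<open>\<parallel>U x\<parallel>\<^sup>2 = \<parallel>U x \<cdot> U x\<parallel> \<le> \<parallel>U y\<parallel> \<parallel>U x\<parallel> + \<parallel>x - y\<parallel> \<parallel>U (U x)\<parallel>\<close>, contradicting Baire's theorem.
  The operator norms are then seminorms for which \<open>T \<mapsto> (T\<^sub>\<alpha>)\<close> is isometric in each coordinate.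
\<close>

section \<open>Multipliers of algebras without square-zero elements\<close>

text \<open>An additive map between abelian groups preserves negatives. All subtraction rules below,
  for products, scalars, multipliers and factors, are instances.\<close>

lemma abelian_group_hom_minus:
  assumes "abelian_group A" "abelian_group B"
    and f: "\<And>x. x \<in> carrier A \<Longrightarrow> f x \<in> carrier B"
    and add: "\<And>x y. \<lbrakk>x \<in> carrier A; y \<in> carrier A\<rbrakk> \<Longrightarrow> f (x \<oplus>\<^bsub>A\<^esub> y) = f x \<oplus>\<^bsub>B\<^esub> f y"
    and x: "x \<in> carrier A" and y: "y \<in> carrier A"
  shows "f (x \<ominus>\<^bsub>A\<^esub> y) = f x \<ominus>\<^bsub>B\<^esub> f y"
proof -
  interpret abelian_group_hom A B f
    using assms
    by (intro abelian_group_homI group_hom.intro group_hom_axioms.intro abelian_group.a_group)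
      (auto simp: hom_def)
  show ?thesis using x y by (simp add: a_minus_def)
qed

context complex_algebra
begin

lemma scalar_smult_closed [simp]: "x \<in> carrier A \<Longrightarrow> c \<odot> x \<in> carrier A"
  using smult_closed[of c x] by (simp add: ring_of_type_algebra_def)

lemma smult_add: "\<lbrakk>x \<in> carrier A; y \<in> carrier A\<rbrakk> \<Longrightarrow> c \<odot> (x \<oplus> y) = c \<odot> x \<oplus> c \<odot> y"
  using smult_r_distr[of c x y] by (simp add: ring_of_type_algebra_def)

lemma add_smult: "x \<in> carrier A \<Longrightarrow> (c + d) \<odot> x = c \<odot> x \<oplus> d \<odot> x"
  using smult_l_distr[of c d x] by (simp add: ring_of_type_algebra_def)

lemma smult_smult: "x \<in> carrier A \<Longrightarrow> (c * d) \<odot> x = c \<odot> (d \<odot> x)"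
  using smult_assoc1[of c d x] by (simp add: ring_of_type_algebra_def)

lemma one_smult [simp]: "x \<in> carrier A \<Longrightarrow> 1 \<odot> x = x"
  using smult_one[of x] by (simp add: ring_of_type_algebra_def)

lemma zero_smult [simp]: "x \<in> carrier A \<Longrightarrow> 0 \<odot> x = \<zero>"
  using smult_l_null[of x] by (simp add: ring_of_type_algebra_def)

lemma minus_one_smult: "x \<in> carrier A \<Longrightarrow> (- 1) \<odot> x = \<ominus> x"
  using add_smult[of x "- 1" 1] by (simp add: M.minus_equality)

lemma minus_self [simp]: "x \<in> carrier A \<Longrightarrow> x \<ominus> x = \<zero>"
  by (simp add: M.minus_eq M.r_neg)

lemma minus_eq_zero_iff:
  assumes "x \<in> carrier A" "y \<in> carrier A"
  shows "x \<ominus> y = \<zero> \<longleftrightarrow> x = y"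
  using assms M.minus_equality[of x "\<ominus> y"] by (auto simp: M.minus_eq M.r_neg)

lemma minus_zero [simp]: "x \<in> carrier A \<Longrightarrow> x \<ominus> \<zero> = x"
  using M.minus_equality[of \<zero> \<zero>] by (simp add: M.minus_eq)

lemma mult_minus_left:
  "\<lbrakk>x \<in> carrier A; y \<in> carrier A; z \<in> carrier A\<rbrakk> \<Longrightarrow> (x \<ominus> y) \<otimes> z = x \<otimes> z \<ominus> y \<otimes> z"
  by (rule abelian_group_hom_minus[of A A "\<lambda>x. x \<otimes> z"])
    (auto simp: mult_closed mult_add_left M.abelian_group_axioms)

lemma mult_minus_right:
  "\<lbrakk>x \<in> carrier A; y \<in> carrier A; z \<in> carrier A\<rbrakk> \<Longrightarrow> z \<otimes> (x \<ominus> y) = z \<otimes> x \<ominus> z \<otimes> y"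
  by (rule abelian_group_hom_minus[of A A "\<lambda>x. z \<otimes> x"])
    (auto simp: mult_closed mult_add_right M.abelian_group_axioms)

lemma zero_mult [simp]: "x \<in> carrier A \<Longrightarrow> \<zero> \<otimes> x = \<zero>"
  using mult_smult_left[of \<zero> x 0] by (simp add: mult_closed)

lemma mult_zero [simp]: "x \<in> carrier A \<Longrightarrow> x \<otimes> \<zero> = \<zero>"
  using mult_smult_right[of x \<zero> 0] by (simp add: mult_closed)

lemma smult_minus:
  "\<lbrakk>x \<in> carrier A; y \<in> carrier A\<rbrakk> \<Longrightarrow> c \<odot> (x \<ominus> y) = c \<odot> x \<ominus> c \<odot> y"
  by (rule abelian_group_hom_minus[of A A "\<lambda>x. c \<odot> x"])
    (auto simp: smult_add M.abelian_group_axioms)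

end

text \<open>Each axiom for \<open>B\<close> is read off at preimages in \<open>A\<close>, where it
  holds; additive inverses in \<open>B\<close> are images of inverses in \<open>A\<close>. The zero
  is matched separately because it is an independent field of the record.\<close>

lemma complex_algebra_image:
  assumes "complex_algebra A"
    and carrier: "f ` carrier A = carrier B"
    and zero: "f \<zero>\<^bsub>A\<^esub> = \<zero>\<^bsub>B\<^esub>"
    and add: "\<And>x y. \<lbrakk>x \<in> carrier A; y \<in> carrier A\<rbrakk> \<Longrightarrow> f (x \<oplus>\<^bsub>A\<^esub> y) = f x \<oplus>\<^bsub>B\<^esub> f y"
    and mult: "\<And>x y. \<lbrakk>x \<in> carrier A; y \<in> carrier A\<rbrakk> \<Longrightarrow> f (x \<otimes>\<^bsub>A\<^esub> y) = f x \<otimes>\<^bsub>B\<^esub> f y"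
    and smult: "\<And>c x. x \<in> carrier A \<Longrightarrow> f (c \<odot>\<^bsub>A\<^esub> x) = c \<odot>\<^bsub>B\<^esub> f x"
  shows "complex_algebra B"
proof -
  interpret A: complex_algebra A by fact
  have pre: "\<exists>a\<in>carrier A. x = f a" if "x \<in> carrier B" for x
    using that by (auto simp flip: carrier)
  have "abelian_group B"
  proof (rule abelian_groupI)
    fix x assume "x \<in> carrier B"
    then obtain a where a: "a \<in> carrier A" "x = f a" using carrier by auto
    then have "f (\<ominus>\<^bsub>A\<^esub> a) \<oplus>\<^bsub>B\<^esub> x = \<zero>\<^bsub>B\<^esub>" by (metis A.M.a_inv_closed A.M.l_neg add zero)
    moreover have "f (\<ominus>\<^bsub>A\<^esub> a) \<in> carrier B" using a carrier by auto
    ultimately show "\<exists>y\<in>carrier B. y \<oplus>\<^bsub>B\<^esub> x = \<zero>\<^bsub>B\<^esub>" by blast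
  next
    fix x y z assume "x \<in> carrier B" "y \<in> carrier B" "z \<in> carrier B"
    then obtain a b c where "a \<in> carrier A" "b \<in> carrier A" "c \<in> carrier A" "x = f a" "y = f b" "z = f c"
      using pre by metis
    then show "x \<oplus>\<^bsub>B\<^esub> y \<oplus>\<^bsub>B\<^esub> z = x \<oplus>\<^bsub>B\<^esub> (y \<oplus>\<^bsub>B\<^esub> z)"
      by (metis A.M.a_assoc A.M.a_closed add)
  next
    fix x y assume "x \<in> carrier B" "y \<in> carrier B"
    then obtain a b where "a \<in> carrier A" "b \<in> carrier A" "x = f a" "y = f b"
      using pre by metis
    then show "x \<oplus>\<^bsub>B\<^esub> y = y \<oplus>\<^bsub>B\<^esub> x"
      by (metis A.M.a_comm add)
  next
    fix x y assume "x \<in> carrier B" "y \<in> carrier B"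
    then show "x \<oplus>\<^bsub>B\<^esub> y \<in> carrier B"
      using add carrier by (metis A.M.a_closed imageI pre)
  next
    fix x assume "x \<in> carrier B"
    then show "\<zero>\<^bsub>B\<^esub> \<oplus>\<^bsub>B\<^esub> x = x"
      using add zero by (metis A.M.l_zero A.M.zero_closed pre)
  next
    show "\<zero>\<^bsub>B\<^esub> \<in> carrier B"
      using zero carrier by (metis A.M.zero_closed imageI)
  qed
  note closed = A.M.a_closed A.mult_closed A.scalar_smult_closed
  have smult_B: "c \<odot>\<^bsub>B\<^esub> x \<in> carrier B" if "x \<in> carrier B" for c x
    using that smult carrier closed(3) by (metis imageI pre)
  show ?thesis
  proof (intro complex_algebra.intro moduleI complex_algebra_axioms.intro A.R.is_cring)
    fix c d x y z
    assume "x \<in> carrier B" then obtain x' where x: "x' \<in> carrier A" "x = f x'" using pre by auto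
    show "(c \<oplus>\<^bsub>ring_of_type_algebra\<^esub> d) \<odot>\<^bsub>B\<^esub> x = c \<odot>\<^bsub>B\<^esub> x \<oplus>\<^bsub>B\<^esub> d \<odot>\<^bsub>B\<^esub> x"
      unfolding ring_of_type_algebra_def using x by (simp, metis A.add_smult add smult closed)
    show "(c \<otimes>\<^bsub>ring_of_type_algebra\<^esub> d) \<odot>\<^bsub>B\<^esub> x = c \<odot>\<^bsub>B\<^esub> (d \<odot>\<^bsub>B\<^esub> x)"
      unfolding ring_of_type_algebra_def using x by (simp, metis A.smult_smult smult closed)
    show "\<one>\<^bsub>ring_of_type_algebra\<^esub> \<odot>\<^bsub>B\<^esub> x = x"
      unfolding ring_of_type_algebra_def using x by (simp, metis A.one_smult smult)
    assume "y \<in> carrier B" then obtain y' where y: "y' \<in> carrier A" "y = f y'" using pre by auto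
    show "c \<odot>\<^bsub>B\<^esub> (x \<oplus>\<^bsub>B\<^esub> y) = c \<odot>\<^bsub>B\<^esub> x \<oplus>\<^bsub>B\<^esub> c \<odot>\<^bsub>B\<^esub> y"
      using x y by (metis A.smult_add add smult closed)
    show "x \<otimes>\<^bsub>B\<^esub> y \<in> carrier B"
      using x y carrier by (metis closed(2) imageI mult)
    show "(c \<odot>\<^bsub>B\<^esub> x) \<otimes>\<^bsub>B\<^esub> y = c \<odot>\<^bsub>B\<^esub> (x \<otimes>\<^bsub>B\<^esub> y)"
      using x y by (metis A.mult_smult_left mult smult closed)
    show "x \<otimes>\<^bsub>B\<^esub> (c \<odot>\<^bsub>B\<^esub> y) = c \<odot>\<^bsub>B\<^esub> (x \<otimes>\<^bsub>B\<^esub> y)"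
      using x y by (metis A.mult_smult_right mult smult closed)
    assume "z \<in> carrier B" then obtain z' where z: "z' \<in> carrier A" "z = f z'" using pre by auto
    show "(x \<otimes>\<^bsub>B\<^esub> y) \<otimes>\<^bsub>B\<^esub> z = x \<otimes>\<^bsub>B\<^esub> (y \<otimes>\<^bsub>B\<^esub> z)"
      using x y z by (metis A.mult_assoc mult closed)
    show "(x \<oplus>\<^bsub>B\<^esub> y) \<otimes>\<^bsub>B\<^esub> z = x \<otimes>\<^bsub>B\<^esub> z \<oplus>\<^bsub>B\<^esub> y \<otimes>\<^bsub>B\<^esub> z"
      using x y z by (metis A.mult_add_left mult add closed)
    show "z \<otimes>\<^bsub>B\<^esub> (x \<oplus>\<^bsub>B\<^esub> y) = z \<otimes>\<^bsub>B\<^esub> x \<oplus>\<^bsub>B\<^esub> z \<otimes>\<^bsub>B\<^esub> y"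
      using x y z by (metis A.mult_add_right mult add closed)
  qed (use \<open>abelian_group B\<close> smult_B in auto)
qed

section \<open>Multipliers as an additive group\<close>

lemma multipliers_closed: "\<lbrakk>T \<in> multipliers A; x \<in> carrier A\<rbrakk> \<Longrightarrow> T x \<in> carrier A"
  by (auto simp: multipliers_def)

lemma multipliers_mult:
  "\<lbrakk>T \<in> multipliers A; x \<in> carrier A; y \<in> carrier A\<rbrakk> \<Longrightarrow> T x \<otimes>\<^bsub>A\<^esub> y = x \<otimes>\<^bsub>A\<^esub> T y"
  by (auto simp: multipliers_def)

lemma multipliers_ext:
  assumes "S \<in> multipliers A" "T \<in> multipliers A" "\<And>x. x \<in> carrier A \<Longrightarrow> S x = T x"
  shows "S = T"
  using assms by (auto simp: multipliers_def intro: PiE_ext)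

lemma carrier_multiplier_algebra [simp]: "carrier (multiplier_algebra A) = multipliers A"
  by (simp add: multiplier_algebra_def)

lemma (in complex_algebra) zero_multiplier: "(\<lambda>x\<in>carrier A. \<zero>) \<in> multipliers A"
  by (simp add: multipliers_def)

lemma (in complex_algebra) add_multiplier:
  assumes "S \<in> multipliers A" "T \<in> multipliers A"
  shows "(\<lambda>x\<in>carrier A. S x \<oplus> T x) \<in> multipliers A"
proof -
  have "S x \<in> carrier A \<and> T x \<in> carrier A" if "x \<in> carrier A" for x
    using assms that by (simp add: multipliers_closed)
  then show ?thesis
    using assms by (simp add: multipliers_def mult_add_left mult_add_right)
qed

lemma (in complex_algebra) smult_multiplier:
  assumes "T \<in> multipliers A"
  shows "(\<lambda>x\<in>carrier A. c \<odot> T x) \<in> multipliers A"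
proof -
  have "T x \<in> carrier A" if "x \<in> carrier A" for x
    using assms that by (simp add: multipliers_closed)
  then show ?thesis
    using assms by (simp add: multipliers_def mult_smult_left mult_smult_right)
qed

text \<open>The seminorm topologies on multiplier algebras are built from balls around points, hence
  from subtraction; the group structure makes this subtraction usable.\<close>

lemma (in complex_algebra) abelian_group_multiplier_algebra: "abelian_group (multiplier_algebra A)"
proof (rule abelian_groupI)
  fix S assume S: "S \<in> carrier (multiplier_algebra A)"
  then have SA: "S x \<in> carrier A" if "x \<in> carrier A" for x
    using that by (auto simp: multiplier_algebra_def multipliers_closed)
  \<comment> \<open>The negative is taken as the scalar multiple by -1, so that it is a multiplier
    by the scalar rules of the product.\<close>
  let ?N = "\<lambda>x\<in>carrier A. (- 1) \<odot> S x"
  have "?N \<in> carrier (multiplier_algebra A)"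
    using S SA by (simp add: multiplier_algebra_def multipliers_def mult_smult_left mult_smult_right)
  moreover have "?N \<oplus>\<^bsub>multiplier_algebra A\<^esub> S = \<zero>\<^bsub>multiplier_algebra A\<^esub>"
    using SA by (auto simp: multiplier_algebra_def minus_one_smult M.l_neg)
  ultimately show "\<exists>N\<in>carrier (multiplier_algebra A).
      N \<oplus>\<^bsub>multiplier_algebra A\<^esub> S = \<zero>\<^bsub>multiplier_algebra A\<^esub>" by blast
next
  fix S assume "S \<in> carrier (multiplier_algebra A)"
  then have "S \<in> multipliers A" by (simp add: multiplier_algebra_def)
  then show "\<zero>\<^bsub>multiplier_algebra A\<^esub> \<oplus>\<^bsub>multiplier_algebra A\<^esub> S = S"
    using add_multiplier[OF zero_multiplier]
    by (intro multipliers_ext[of _ A]) (simp_all add: multiplier_algebra_def multipliers_closed)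
next
  fix S T U
  assume "S \<in> carrier (multiplier_algebra A)" "T \<in> carrier (multiplier_algebra A)" "U \<in> carrier (multiplier_algebra A)"
  then show "S \<oplus>\<^bsub>multiplier_algebra A\<^esub> T \<oplus>\<^bsub>multiplier_algebra A\<^esub> U =
      S \<oplus>\<^bsub>multiplier_algebra A\<^esub> (T \<oplus>\<^bsub>multiplier_algebra A\<^esub> U)"
    by (auto simp: multiplier_algebra_def multipliers_closed M.a_assoc)
next
  fix S T assume "S \<in> carrier (multiplier_algebra A)" "T \<in> carrier (multiplier_algebra A)"
  then show "S \<oplus>\<^bsub>multiplier_algebra A\<^esub> T = T \<oplus>\<^bsub>multiplier_algebra A\<^esub> S"
    by (auto simp: multiplier_algebra_def multipliers_closed M.a_comm)
qed (simp_all add: multiplier_algebra_def zero_multiplier add_multiplier)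

section \<open>Linearity of multipliers in reduced algebras\<close>

text \<open>This is the form in which properness is used: an element that annihilates the algebra
  has square zero. The uniform identity q(xx) = q(x)q(x) provides it both for the algebra and for
  its factors.\<close>

locale reduced_algebra = complex_algebra A
  for A :: "(complex, 'a) module" (structure) +
  assumes reduced: "\<lbrakk>x \<in> carrier A; x \<otimes> x = \<zero>\<rbrakk> \<Longrightarrow> x = \<zero>"

context reduced_algebra
begin

text \<open>The difference x - y annihilates everything, in particular itself, so its square is
  zero.\<close>

lemma eq_if_mult_eq:
  assumes "x \<in> carrier A" "y \<in> carrier A" "\<And>z. z \<in> carrier A \<Longrightarrow> x \<otimes> z = y \<otimes> z"
  shows "x = y"
proof -
  have "(x \<ominus> y) \<otimes> (x \<ominus> y) = \<zero>"
    using assms by (simp add: mult_minus_left mult_closed)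
  then show ?thesis using reduced[of "x \<ominus> y"] assms by (simp add: minus_eq_zero_iff)
qed

context
  fixes T assumes T: "T \<in> multipliers A"
begin

text \<open>After multiplication by an arbitrary z on the right, \<open>T\<close> can be moved onto
  z on both sides, and what remains is an identity of the product. Additivity and homogeneity follow
  in the same way.\<close>

lemma multiplier_mult:
  assumes "x \<in> carrier A" "y \<in> carrier A"
  shows "T (x \<otimes> y) = T x \<otimes> y"
  by (rule eq_if_mult_eq)
    (use assms T in \<open>simp_all add: multipliers_closed multipliers_mult[OF T] mult_closed mult_assoc\<close>)

lemma multiplier_add:
  assumes "x \<in> carrier A" "y \<in> carrier A"
  shows "T (x \<oplus> y) = T x \<oplus> T y"
  by (rule eq_if_mult_eq)
    (use assms T in \<open>simp_all add: multipliers_closed multipliers_mult[OF T] mult_add_left\<close>)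

lemma multiplier_smult:
  assumes "x \<in> carrier A"
  shows "T (c \<odot> x) = c \<odot> T x"
  by (rule eq_if_mult_eq)
    (use assms T in \<open>simp_all add: multipliers_closed multipliers_mult[OF T] mult_smult_left\<close>)

lemma multiplier_minus:
  "\<lbrakk>x \<in> carrier A; y \<in> carrier A\<rbrakk> \<Longrightarrow> T (x \<ominus> y) = T x \<ominus> T y"
  by (rule abelian_group_hom_minus)
    (auto simp: multipliers_closed[OF T] multiplier_add M.abelian_group_axioms)

end

lemma compose_multiplier:
  assumes "S \<in> multipliers A" "T \<in> multipliers A"
  shows "compose (carrier A) S T \<in> multipliers A"
proof -
  have "S (T x) \<otimes> y = x \<otimes> S (T y)" if "x \<in> carrier A" "y \<in> carrier A" for x y
  proof -
    have "S (T x) \<otimes> y = S (T x \<otimes> y)"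
      using that assms by (simp add: multiplier_mult multipliers_closed)
    also have "\<dots> = S (x \<otimes> T y)" using that assms by (simp add: multipliers_mult)
    also have "\<dots> = x \<otimes> S (T y)"
      using that assms by (simp add: multiplier_mult multipliers_closed multipliers_mult)
    finally show ?thesis .
  qed
  then show ?thesis using assms by (auto simp: multipliers_def compose_def)
qed

end

section \<open>Factors of seminorms\<close>

locale seminormed_algebra = complex_algebra A
  for A :: "(complex, 'a) module" (structure) +
  fixes q :: "'a \<Rightarrow> real"
  assumes seminorm: "algebra_seminorm A q"
begin

abbreviation "K \<equiv> seminorm_kernel A q"

abbreviation "F \<equiv> factor_algebra A q"

abbreviation "proj \<equiv> factor_proj A q"

lemma nonneg: "x \<in> carrier A \<Longrightarrow> 0 \<le> q x"
  and scale: "x \<in> carrier A \<Longrightarrow> q (c \<odot> x) = cmod c * q x"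
  and triangle: "\<lbrakk>x \<in> carrier A; y \<in> carrier A\<rbrakk> \<Longrightarrow> q (x \<oplus> y) \<le> q x + q y"
  and submult: "\<lbrakk>x \<in> carrier A; y \<in> carrier A\<rbrakk> \<Longrightarrow> q (x \<otimes> y) \<le> q x * q y"
  using seminorm by (simp_all add: algebra_seminorm_def)

lemma zero [simp]: "q \<zero> = 0"
  using scale[of \<zero> 0] by simp

lemma minus: "x \<in> carrier A \<Longrightarrow> q (\<ominus> x) = q x"
  using scale[of x "- 1"] by (simp add: minus_one_smult)

lemma diff_commute: "\<lbrakk>x \<in> carrier A; y \<in> carrier A\<rbrakk> \<Longrightarrow> q (x \<ominus> y) = q (y \<ominus> x)"
  using minus[of "x \<ominus> y"] by (simp add: M.minus_eq M.minus_add M.a_comm)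

lemma triangle_diff:
  assumes "x \<in> carrier A" "y \<in> carrier A" "z \<in> carrier A"
  shows "q (x \<ominus> z) \<le> q (x \<ominus> y) + q (y \<ominus> z)"
proof -
  have "x \<ominus> z = (x \<ominus> y) \<oplus> (y \<ominus> z)"
    using assms by (simp add: M.minus_eq M.a_assoc M.r_neg1)
  then show ?thesis using triangle[of "x \<ominus> y" "y \<ominus> z"] assms by simp
qed

lemma diff_le: "\<lbrakk>x \<in> carrier A; y \<in> carrier A\<rbrakk> \<Longrightarrow> q x - q y \<le> q (x \<ominus> y)"
  using triangle_diff[of x y \<zero>] by simp

lemma eq_if_diff_zero:
  assumes "x \<in> carrier A" "y \<in> carrier A" "q (x \<ominus> y) = 0"
  shows "q x = q y"
  using diff_le[of x y] diff_le[of y x] diff_commute[of x y] assms by simp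

lemma mult_eq_zero_left: "\<lbrakk>x \<in> carrier A; y \<in> carrier A; q x = 0\<rbrakk> \<Longrightarrow> q (x \<otimes> y) = 0"
  using submult[of x y] nonneg[of "x \<otimes> y"] by (simp add: mult_closed)

lemma mult_eq_zero_right: "\<lbrakk>x \<in> carrier A; y \<in> carrier A; q y = 0\<rbrakk> \<Longrightarrow> q (x \<otimes> y) = 0"
  using submult[of x y] nonneg[of "x \<otimes> y"] by (simp add: mult_closed)

lemma kernel_subgroup: "abelian_subgroup K A"
proof (rule abelian_subgroupI3)
  have "q (x \<oplus> y) = 0" if "x \<in> carrier A" "y \<in> carrier A" "q x = 0" "q y = 0" for x y
    using triangle[of x y] nonneg[of "x \<oplus> y"] that by simp
  then show "additive_subgroup K A"
    by (intro additive_subgroup.intro M.add.subgroupI)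
      (auto simp: seminorm_kernel_def minus)
qed (rule M.abelian_group_axioms)

lemma proj_eq_iff:
  assumes "x \<in> carrier A" "y \<in> carrier A"
  shows "proj x = proj y \<longleftrightarrow> q (x \<ominus> y) = 0"
proof -
  note K = kernel_subgroup
  have "proj x = proj y \<longleftrightarrow> x \<in> K +> y"
    unfolding factor_proj_def
    using abelian_subgroup.a_repr_independence'[OF K, of x y] abelian_subgroup.a_repr_independenceD[OF K, of x y] assms by metis
  also have "\<dots> \<longleftrightarrow> x \<ominus> y \<in> K"
    unfolding M.minus_eq using assms(2,1) by (rule abelian_subgroup.a_rcos_module[OF K])
  also have "\<dots> \<longleftrightarrow> q (x \<ominus> y) = 0"
    using assms by (simp add: seminorm_kernel_def)
  finally show ?thesis .
qed

text \<open>Elements of a factor are themselves subsets of the algebra. This description evaluates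
  the unions over cosets in the definitions and later makes the cosets usable as a filter
  base.\<close>

lemma mem_proj_iff:
  assumes "x \<in> carrier A"
  shows "a \<in> proj x \<longleftrightarrow> a \<in> carrier A \<and> proj a = proj x"
proof -
  note K = kernel_subgroup
  show ?thesis
    unfolding factor_proj_def
    using abelian_subgroup.a_repr_independence'[OF K, of a x] abelian_subgroup.a_repr_independenceD[OF K, of a x]
      abelian_subgroup.a_elemrcos_carrier[OF K, of x a] assms by metis
qed

lemma carrier_factor: "carrier F = proj ` carrier A"
  by (auto simp: factor_algebra_def quotient_algebra_def FactRing_simps factor_proj_def[abs_def])

lemma proj_closed [simp]: "x \<in> carrier A \<Longrightarrow> proj x \<in> carrier F"
  by (simp add: carrier_factor)

lemma factor_add:
  assumes "x \<in> carrier A" "y \<in> carrier A"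
  shows "proj x \<oplus>\<^bsub>F\<^esub> proj y = proj (x \<oplus> y)"
proof -
  note K = kernel_subgroup
  show ?thesis
    using assms abelian_subgroup.a_rcos_sum[OF K]
    by (simp add: factor_algebra_def quotient_algebra_def FactRing_def factor_proj_def)
qed

lemma factor_zero: "\<zero>\<^bsub>F\<^esub> = proj \<zero>"
proof -
  have "K \<subseteq> carrier A" by (auto simp: seminorm_kernel_def)
  then show ?thesis
    using M.a_coset_add_zero
    by (simp add: factor_algebra_def quotient_algebra_def FactRing_def factor_proj_def)
qed

text \<open>The product of two cosets is a union over all pairs of representatives. It collapses to
  a single coset because the kernel of a submultiplicative seminorm is a two-sided ideal.\<close>

lemma factor_mult:
  assumes x: "x \<in> carrier A" and y: "y \<in> carrier A"
  shows "proj x \<otimes>\<^bsub>F\<^esub> proj y = proj (x \<otimes> y)"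
proof -
  have *: "proj (a \<otimes> b) = proj (x \<otimes> y)" if a: "a \<in> proj x" and b: "b \<in> proj y" for a b
  proof -
    have ab: "a \<in> carrier A" "b \<in> carrier A" "q (a \<ominus> x) = 0" "q (b \<ominus> y) = 0"
      using a b x y proj_eq_iff by (auto simp: mem_proj_iff)
    \<comment> \<open>The intermediate point \<open>x \<otimes> b\<close> splits the difference into
      two products, each with one factor in the kernel.\<close>
    have "q (a \<otimes> b \<ominus> x \<otimes> y) \<le> q ((a \<ominus> x) \<otimes> b) + q (x \<otimes> (b \<ominus> y))"
      using triangle_diff[of "a \<otimes> b" "x \<otimes> b" "x \<otimes> y"] ab x y
      by (simp add: mult_minus_left mult_minus_right mult_closed)
    also have "\<dots> = 0"
      using ab x y by (simp add: mult_eq_zero_left mult_eq_zero_right)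
    finally show ?thesis
      using ab x y nonneg[of "a \<otimes> b \<ominus> x \<otimes> y"] by (simp add: proj_eq_iff mult_closed)
  qed
  have "proj x \<otimes>\<^bsub>F\<^esub> proj y = (\<Union>a\<in>proj x. \<Union>b\<in>proj y. proj (a \<otimes> b))"
    by (simp add: factor_algebra_def quotient_algebra_def FactRing_def rcoset_mult_def factor_proj_def)
  also have "\<dots> = (\<Union>a\<in>proj x. \<Union>b\<in>proj y. proj (x \<otimes> y))"
    using * by (intro SUP_cong refl) auto
  also have "\<dots> = proj (x \<otimes> y)"
    using x y mem_proj_iff by fastforce
  finally show ?thesis .
qed

lemma factor_smult:
  assumes x: "x \<in> carrier A"
  shows "c \<odot>\<^bsub>F\<^esub> proj x = proj (c \<odot> x)"
proof -
  have *: "proj (c \<odot> a) = proj (c \<odot> x)" if "a \<in> proj x" for a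
  proof -
    have "a \<in> carrier A" "q (a \<ominus> x) = 0"
      using that x proj_eq_iff by (auto simp: mem_proj_iff)
    then show ?thesis
      using x scale[of "a \<ominus> x" c] by (simp add: proj_eq_iff smult_minus)
  qed
  have "c \<odot>\<^bsub>F\<^esub> proj x = (\<Union>a\<in>proj x. proj (c \<odot> a))"
    by (simp add: factor_algebra_def quotient_algebra_def factor_proj_def)
  also have "\<dots> = (\<Union>a\<in>proj x. proj (c \<odot> x))"
    using * by (intro SUP_cong refl) auto
  also have "\<dots> = proj (c \<odot> x)"
    using x mem_proj_iff by fastforce
  finally show ?thesis .
qed

lemma complex_algebra_factor: "complex_algebra F"
  by (rule complex_algebra_image[OF complex_algebra_axioms, of proj])
    (auto simp: carrier_factor factor_zero factor_add factor_mult factor_smult)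

lemma factor_minus:
  assumes "x \<in> carrier A" "y \<in> carrier A"
  shows "proj x \<ominus>\<^bsub>F\<^esub> proj y = proj (x \<ominus> y)"
proof -
  interpret F: complex_algebra F by (rule complex_algebra_factor)
  show ?thesis
    by (rule abelian_group_hom_minus[symmetric])
      (use assms in \<open>simp_all add: factor_add M.abelian_group_axioms F.M.abelian_group_axioms\<close>)
qed

lemma factor_norm_proj:
  assumes x: "x \<in> carrier A"
  shows "factor_norm q (proj x) = q x"
proof -
  have "q a = q x" if "a \<in> proj x" for a
  proof (rule eq_if_diff_zero)
    show "a \<in> carrier A" using that x mem_proj_iff by blast
    then show "q (a \<ominus> x) = 0" using that x proj_eq_iff mem_proj_iff by blast
  qed fact
  moreover have "proj x \<noteq> {}" using x mem_proj_iff by blast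
  ultimately show ?thesis
    unfolding factor_norm_def by (intro the_elem_image_unique)
qed

lemma seminormed_factor: "seminormed_algebra F (factor_norm q)"
proof (intro seminormed_algebra.intro seminormed_algebra_axioms.intro complex_algebra_factor)
  show "algebra_seminorm F (factor_norm q)"
    unfolding algebra_seminorm_def carrier_factor ball_simps
    by (simp add: factor_norm_proj factor_add factor_mult factor_smult mult_closed
        nonneg scale triangle submult)
qed

lemma factor_norm_eq_zero_iff:
  assumes "C \<in> carrier F"
  shows "factor_norm q C = 0 \<longleftrightarrow> C = \<zero>\<^bsub>F\<^esub>"
proof -
  obtain x where "x \<in> carrier A" "C = proj x"
    using assms carrier_factor by blast
  then show ?thesis
    using proj_eq_iff[of x \<zero>] by (simp add: factor_norm_proj factor_zero)
qed

text \<open>Since r is dominated by q, the kernel of q lies in that of r, so all representatives of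
  a coset of the former have the same class for r.\<close>

lemma factor_map_proj:
  assumes r: "seminorm_le A r q" "seminormed_algebra A r" and x: "x \<in> carrier A"
  shows "factor_map A r q (proj x) = factor_proj A r x"
proof -
  interpret r: seminormed_algebra A r by fact
  have *: "factor_proj A r a = factor_proj A r x" if "a \<in> proj x" for a
  proof -
    have a: "a \<in> carrier A" "q (a \<ominus> x) = 0"
      using that x proj_eq_iff by (auto simp: mem_proj_iff)
    moreover have "r (a \<ominus> x) \<le> q (a \<ominus> x)"
      using r(1) a x unfolding seminorm_le_def by (meson M.minus_closed)
    ultimately show ?thesis
      using x r.nonneg[of "a \<ominus> x"] by (simp add: r.proj_eq_iff)
  qed
  have "factor_map A r q (proj x) = (\<Union>a\<in>proj x. factor_proj A r x)"
    unfolding factor_map_def using * by (intro SUP_cong refl) auto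
  also have "\<dots> = factor_proj A r x"
    using x mem_proj_iff by fastforce
  finally show ?thesis .
qed

end

locale uniform_seminormed_algebra = seminormed_algebra +
  assumes uniform: "uniform_seminorm A q"
begin

lemma square: "x \<in> carrier A \<Longrightarrow> q (x \<otimes> x) = (q x)\<^sup>2"
  using uniform by (simp add: uniform_seminorm_def)

text \<open>If the class of x has square zero, then q(x)q(x) = q(xx) = 0, so x lies in the
  kernel.\<close>

lemma reduced_factor: "reduced_algebra F"
proof (intro reduced_algebra.intro reduced_algebra_axioms.intro complex_algebra_factor)
  fix C assume "C \<in> carrier F" and sq: "C \<otimes>\<^bsub>F\<^esub> C = \<zero>\<^bsub>F\<^esub>"
  then obtain x where x: "x \<in> carrier A" "C = proj x"
    using carrier_factor by blast
  then have "proj (x \<otimes> x) = proj \<zero>"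
    using sq by (simp add: factor_mult factor_zero)
  then have "q (x \<otimes> x) = 0"
    using x proj_eq_iff[of "x \<otimes> x" \<zero>] by (simp add: mult_closed)
  then show "C = \<zero>\<^bsub>F\<^esub>"
    using x proj_eq_iff[of x \<zero>] by (simp add: square factor_zero)
qed

text \<open>Makes a factor with its norm an instance of the same locale, so that the boundedness
  theorem for multipliers applies to it.\<close>

lemma uniform_factor: "uniform_seminormed_algebra F (factor_norm q)"
proof (intro uniform_seminormed_algebra.intro uniform_seminormed_algebra_axioms.intro seminormed_factor)
  show "uniform_seminorm F (factor_norm q)"
    using seminormed_factor unfolding uniform_seminorm_def carrier_factor ball_simps
    by (simp add: factor_norm_proj factor_mult mult_closed square
        seminormed_algebra_def seminormed_algebra_axioms_def)
qed

end

section \<open>Transport of multipliers along surjective homomorphisms\<close>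

text \<open>Serves both the projections onto factors and the maps between factors. Surjectivity
  gives uniqueness; existence amounts to f (U x) depending only on f x.\<close>

lemma induced_multiplier_ex1:
  assumes "complex_algebra A" "reduced_algebra B" and U: "U \<in> multipliers A"
    and onto: "f ` carrier A = carrier B"
    and minus: "\<And>x y. \<lbrakk>x \<in> carrier A; y \<in> carrier A\<rbrakk> \<Longrightarrow> f (x \<ominus>\<^bsub>A\<^esub> y) = f x \<ominus>\<^bsub>B\<^esub> f y"
    and mult: "\<And>x y. \<lbrakk>x \<in> carrier A; y \<in> carrier A\<rbrakk> \<Longrightarrow> f (x \<otimes>\<^bsub>A\<^esub> y) = f x \<otimes>\<^bsub>B\<^esub> f y"
  shows "\<exists>!V. V \<in> multipliers B \<and> (\<forall>x\<in>carrier A. V (f x) = f (U x))"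
proof -
  interpret A: complex_algebra A by fact
  interpret B: reduced_algebra B by fact
  have fB: "f x \<in> carrier B" if "x \<in> carrier A" for x using that onto by auto
  have UA: "U x \<in> carrier A" if "x \<in> carrier A" for x using that U by (rule multipliers_closed[rotated])
  have wd: "f (U x) = f (U y)" if xy: "x \<in> carrier A" "y \<in> carrier A" "f x = f y" for x y
  proof -
    let ?w = "U x \<ominus>\<^bsub>A\<^esub> U y"
    have w: "?w \<in> carrier A" using UA xy by simp
    \<comment> \<open>The multiplier identity moves \<open>U\<close> from x and from y onto
      \<open>?w\<close>. The remaining factor x - y is sent to zero by \<open>f\<close>.\<close>
    have "?w \<otimes>\<^bsub>A\<^esub> ?w = (x \<ominus>\<^bsub>A\<^esub> y) \<otimes>\<^bsub>A\<^esub> U ?w"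
      using w xy UA by (simp add: A.mult_minus_left multipliers_mult[OF U])
    then have "f ?w \<otimes>\<^bsub>B\<^esub> f ?w = f (x \<ominus>\<^bsub>A\<^esub> y) \<otimes>\<^bsub>B\<^esub> f (U ?w)"
      using w xy UA by (simp flip: mult)
    also have "\<dots> = \<zero>\<^bsub>B\<^esub>"
      using w xy UA fB by (simp add: minus)
    finally have "f ?w = \<zero>\<^bsub>B\<^esub>" using B.reduced w fB by blast
    then show ?thesis using xy UA fB by (simp add: minus B.minus_eq_zero_iff)
  qed
  define V where "V = (\<lambda>z\<in>carrier B. f (U (inv_into (carrier A) f z)))"
  have V: "V (f x) = f (U x)" if "x \<in> carrier A" for x
  proof -
    let ?y = "inv_into (carrier A) f (f x)"
    have "?y \<in> carrier A" "f ?y = f x"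
      using that by (auto intro: inv_into_into f_inv_into_f)
    then show ?thesis using wd[of ?y x] that fB by (simp add: V_def)
  qed
  have "V \<in> multipliers B"
    unfolding multipliers_def
  proof (intro CollectI conjI ballI PiE_I)
    fix z w assume "z \<in> carrier B" "w \<in> carrier B"
    then obtain x y where "x \<in> carrier A" "y \<in> carrier A" "z = f x" "w = f y"
      using onto by (metis imageE)
    then show "V z \<otimes>\<^bsub>B\<^esub> w = z \<otimes>\<^bsub>B\<^esub> V w"
      using UA by (simp add: V multipliers_mult[OF U] flip: mult)
  next
    fix z assume "z \<in> carrier B"
    then obtain x where "x \<in> carrier A" "z = f x"
      using onto by (metis imageE)
    then show "V z \<in> carrier B" using V UA fB by simp
  qed (simp add: V_def)
  moreover have "W = V" if "W \<in> multipliers B" "\<forall>x\<in>carrier A. W (f x) = f (U x)" for W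
  proof (rule multipliers_ext)
    fix z assume "z \<in> carrier B"
    then obtain x where "x \<in> carrier A" "z = f x"
      using onto by (metis imageE)
    then show "W z = V z" using that V by simp
  qed (use that \<open>V \<in> multipliers B\<close> in auto)
  ultimately show ?thesis using V by blast
qed

lemma
  assumes "complex_algebra A" "reduced_algebra B" "U \<in> multipliers A"
    and "f ` carrier A = carrier B"
    and "\<And>x y. \<lbrakk>x \<in> carrier A; y \<in> carrier A\<rbrakk> \<Longrightarrow> f (x \<ominus>\<^bsub>A\<^esub> y) = f x \<ominus>\<^bsub>B\<^esub> f y"
    and "\<And>x y. \<lbrakk>x \<in> carrier A; y \<in> carrier A\<rbrakk> \<Longrightarrow> f (x \<otimes>\<^bsub>A\<^esub> y) = f x \<otimes>\<^bsub>B\<^esub> f y"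
  shows induced_multiplier: "induced_multiplier A B f U \<in> multipliers B"
    and induced_multiplier_apply: "x \<in> carrier A \<Longrightarrow> induced_multiplier A B f U (f x) = f (U x)"
  using theI'[OF induced_multiplier_ex1[of A B U f, OF assms]]
  unfolding induced_multiplier_def by blast+

text \<open>A multiplier of \<open>B\<close> is determined by its values on the image of
  \<open>f\<close>, which is all of \<open>B\<close>. Identities between induced multipliers thus
  reduce to checking a candidate on classes.\<close>

lemma induced_multiplier_eqI:
  assumes "f ` carrier A = carrier B" "V \<in> multipliers B" "\<And>x. x \<in> carrier A \<Longrightarrow> V (f x) = f (U x)"
  shows "induced_multiplier A B f U = V"
  unfolding induced_multiplier_def
proof (rule the_equality)
  fix W assume W: "W \<in> multipliers B \<and> (\<forall>x\<in>carrier A. W (f x) = f (U x))"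
  show "W = V"
  proof (rule multipliers_ext)
    fix z assume "z \<in> carrier B"
    then obtain x where "x \<in> carrier A" "z = f x" using assms(1) by (metis imageE)
    then show "W z = V z" using W assms by simp
  qed (use W assms in auto)
qed (use assms in auto)

section \<open>Seminorm topologies and boundedness of multipliers\<close>

text \<open>Captures what the topological arguments share for E, for its factors and for the
  multiplier algebras with their operator norms. That \<open>P\<close> is nonempty ensures that the
  balls cover the carrier.\<close>

locale group_seminorms = abelian_group A
  for A :: "(complex, 'a) module" (structure) +
  fixes P :: "('a \<Rightarrow> real) set"
  assumes nonempty: "P \<noteq> {}"
    and zero: "q \<in> P \<Longrightarrow> q \<zero> = 0"
    and triangle: "\<lbrakk>q \<in> P; x \<in> carrier A; y \<in> carrier A\<rbrakk> \<Longrightarrow> q (x \<oplus> y) \<le> q x + q y"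
begin

lemma diff_self: "\<lbrakk>q \<in> P; x \<in> carrier A\<rbrakk> \<Longrightarrow> q (x \<ominus> x) = 0"
  by (simp add: minus_eq r_neg zero)

lemma triangle_diff:
  assumes "q \<in> P" "x \<in> carrier A" "y \<in> carrier A" "z \<in> carrier A"
  shows "q (x \<ominus> z) \<le> q (x \<ominus> y) + q (y \<ominus> z)"
proof -
  have "x \<ominus> z = (x \<ominus> y) \<oplus> (y \<ominus> z)"
    using assms by (simp add: minus_eq a_assoc r_neg1)
  then show ?thesis using triangle[of q "x \<ominus> y" "y \<ominus> z"] assms by simp
qed

lemma openin_ball:
  assumes "q \<in> P" "x \<in> carrier A" "0 < e"
  shows "openin (seminorm_topology A P) {y \<in> carrier A. q (y \<ominus> x) < e}"
  unfolding seminorm_topology_def using assms by (intro topology_generated_by_Basis) auto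

lemma topspace_seminorm_topology: "topspace (seminorm_topology A P) = carrier A"
proof
  show "topspace (seminorm_topology A P) \<subseteq> carrier A"
    by (auto simp: seminorm_topology_def)
  show "carrier A \<subseteq> topspace (seminorm_topology A P)"
  proof
    fix x assume x: "x \<in> carrier A"
    obtain q where q: "q \<in> P" using nonempty by blast
    have "x \<in> {y \<in> carrier A. q (y \<ominus> x) < 1}" using x q by (simp add: diff_self)
    then show "x \<in> topspace (seminorm_topology A P)"
      using openin_ball[OF q x, of 1] openin_subset by fastforce
  qed
qed

text \<open>The generating balls have arbitrary centres, but closeness to \<open>l\<close> is
  enough: this follows by induction on the generation of \<open>U\<close>. The general
  \<open>f\<close> and \<open>G\<close> cover limits, differences along a product filter and a
  single point.\<close>

lemma eventually_in_open:
  assumes "openin (seminorm_topology A P) U" "l \<in> U"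
    and ev: "\<And>q e. \<lbrakk>q \<in> P; 0 < e\<rbrakk> \<Longrightarrow> \<forall>\<^sub>F z in G. f z \<in> carrier A \<and> q (f z \<ominus> l) < e"
  shows "\<forall>\<^sub>F z in G. f z \<in> U"
proof -
  have "generate_topology_on {{y \<in> carrier A. q (y \<ominus> x) < e} | q x e. q \<in> P \<and> x \<in> carrier A \<and> 0 < e} U"
    using assms(1) unfolding seminorm_topology_def by (rule openin_topology_generated_by)
  then show ?thesis using \<open>l \<in> U\<close>
  proof induction
    case (Int U V)
    then show ?case by (auto simp: eventually_conj_iff)
  next
    case (UN K)
    then obtain k where "k \<in> K" "l \<in> k" by blast
    with UN have "\<forall>\<^sub>F z in G. f z \<in> k" by blast
    then show ?case using \<open>k \<in> K\<close> by (auto elim: eventually_mono)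
  next
    case (Basis V)
    then obtain q x e where q: "q \<in> P" "x \<in> carrier A" "0 < e"
      and V: "V = {y \<in> carrier A. q (y \<ominus> x) < e}" by blast
    have l: "l \<in> carrier A" "q (l \<ominus> x) < e" using Basis V by auto
    \<comment> \<open>The ball around x is recentred at l: the radius left over is e - q(l -
      x).\<close>
    have "\<forall>\<^sub>F z in G. f z \<in> carrier A \<and> q (f z \<ominus> l) < e - q (l \<ominus> x)"
      using ev q l by simp
    then show ?case
    proof eventually_elim
      case (elim z)
      then show ?case using triangle_diff[of q "f z" l x] q l V by simp
    qed
  qed simp
qed

lemma limitin_seminorm_topology:
  "limitin (seminorm_topology A P) f l G \<longleftrightarrow>
     l \<in> carrier A \<and> (\<forall>q\<in>P. \<forall>e>0. \<forall>\<^sub>F z in G. f z \<in> carrier A \<and> q (f z \<ominus> l) < e)"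
proof (intro iffI conjI ballI allI impI)
  assume L: "limitin (seminorm_topology A P) f l G"
  then show l: "l \<in> carrier A" by (simp add: limitin_def topspace_seminorm_topology)
  fix q e assume "q \<in> P" "0 < (e::real)"
  then show "\<forall>\<^sub>F z in G. f z \<in> carrier A \<and> q (f z \<ominus> l) < e"
    using L openin_ball[of q l e] l diff_self[of q l] unfolding limitin_def by auto
next
  assume "l \<in> carrier A \<and> (\<forall>q\<in>P. \<forall>e>0. \<forall>\<^sub>F z in G. f z \<in> carrier A \<and> q (f z \<ominus> l) < e)"
  then show "limitin (seminorm_topology A P) f l G"
    unfolding limitin_def topspace_seminorm_topology using eventually_in_open by blast
qed

text \<open>Reduces the Cauchy condition over all neighbourhoods of zero to one seminorm at a time.
  In the product of \<open>G\<close> with itself a single predicate \<open>Q\<close> can control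
  both coordinates.\<close>

lemma complete_algebraD:
  assumes "complete_algebra A (seminorm_topology A P)"
    and "G \<noteq> bot" "G \<le> principal (carrier A)"
    and cauchy: "\<And>q e. \<lbrakk>q \<in> P; 0 < e\<rbrakk> \<Longrightarrow>
      \<exists>Q. eventually Q G \<and> (\<forall>x y. Q x \<longrightarrow> Q y \<longrightarrow> x \<in> carrier A \<and> y \<in> carrier A \<and> q (x \<ominus> y) < e)"
  obtains l where "limitin (seminorm_topology A P) (\<lambda>x. x) l G"
proof -
  have "\<forall>\<^sub>F (x, y) in G \<times>\<^sub>F G. x \<ominus> y \<in> U"
    if U: "openin (seminorm_topology A P) U" "\<zero> \<in> U" for U
  proof -
    have "\<forall>\<^sub>F z in G \<times>\<^sub>F G. (case z of (x, y) \<Rightarrow> x \<ominus> y) \<in> U"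
    proof (rule eventually_in_open[OF U])
      fix q e assume "q \<in> P" "0 < (e::real)"
      then obtain Q where "eventually Q G"
        "\<And>x y. Q x \<Longrightarrow> Q y \<Longrightarrow> x \<in> carrier A \<and> y \<in> carrier A \<and> q (x \<ominus> y) < e"
        using cauchy by blast
      moreover have "x \<ominus> y \<ominus> \<zero> = x \<ominus> y" if "x \<in> carrier A" "y \<in> carrier A" for x y
        using that minus_equality[of \<zero> \<zero>] by (simp add: minus_eq)
      ultimately show "\<forall>\<^sub>F z in G \<times>\<^sub>F G. (case z of (x, y) \<Rightarrow> x \<ominus> y) \<in> carrier A \<and>
          q ((case z of (x, y) \<Rightarrow> x \<ominus> y) \<ominus> \<zero>) < e"
        unfolding eventually_prod_same by (intro exI[of _ Q]) auto
    qed
    then show ?thesis by (simp add: case_prod_unfold)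
  qed
  then show thesis
    using assms(1-3) that unfolding complete_algebra_def by blast
qed

end

text \<open>It suffices that preimages of generating balls are open; additivity reduces the estimate
  near a point to the bound at a difference.\<close>

lemma continuous_map_seminorm_topology:
  assumes "group_seminorms A P" "group_seminorms B Q"
    and f: "\<And>x. x \<in> carrier A \<Longrightarrow> f x \<in> carrier B"
    and minus: "\<And>x y. \<lbrakk>x \<in> carrier A; y \<in> carrier A\<rbrakk> \<Longrightarrow> f (x \<ominus>\<^bsub>A\<^esub> y) = f x \<ominus>\<^bsub>B\<^esub> f y"
    and bound: "\<And>q. q \<in> Q \<Longrightarrow> \<exists>r\<in>P. \<exists>c\<ge>0. \<forall>x\<in>carrier A. q (f x) \<le> c * r x"
  shows "continuous_map (seminorm_topology A P) (seminorm_topology B Q) f"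
proof -
  interpret A: group_seminorms A P by fact
  interpret B: group_seminorms B Q by fact
  have ball: "openin (seminorm_topology A P) {x \<in> carrier A. q (f x \<ominus>\<^bsub>B\<^esub> y) < e}"
    if q: "q \<in> Q" and y: "y \<in> carrier B" for q y e
  proof (subst openin_subopen, intro ballI)
    fix x assume "x \<in> {x \<in> carrier A. q (f x \<ominus>\<^bsub>B\<^esub> y) < e}"
    then have x: "x \<in> carrier A" "q (f x \<ominus>\<^bsub>B\<^esub> y) < e" by auto
    obtain r c where r: "r \<in> P" "0 \<le> c" "\<And>x. x \<in> carrier A \<Longrightarrow> q (f x) \<le> c * r x"
      using bound[OF q] by blast
    \<comment> \<open>The denominator c + 1 keeps d defined and positive when c = 0, and makes c d
      strictly smaller than the available gap.\<close>
    define d where "d = (e - q (f x \<ominus>\<^bsub>B\<^esub> y)) / (c + 1)"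
    have d: "0 < d" "c * d < e - q (f x \<ominus>\<^bsub>B\<^esub> y)"
      using x r(2) by (simp_all add: d_def field_simps)
    let ?T = "{x' \<in> carrier A. r (x' \<ominus>\<^bsub>A\<^esub> x) < d}"
    have "q (f x' \<ominus>\<^bsub>B\<^esub> y) < e" if "x' \<in> ?T" for x'
    proof -
      have x': "x' \<in> carrier A" "r (x' \<ominus>\<^bsub>A\<^esub> x) \<le> d" using that by auto
      have "q (f x' \<ominus>\<^bsub>B\<^esub> y) \<le> q (f x' \<ominus>\<^bsub>B\<^esub> f x) + q (f x \<ominus>\<^bsub>B\<^esub> y)"
        using B.triangle_diff q x x' y f by blast
      also have "q (f x' \<ominus>\<^bsub>B\<^esub> f x) \<le> c * r (x' \<ominus>\<^bsub>A\<^esub> x)"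
        using r(3)[of "x' \<ominus>\<^bsub>A\<^esub> x"] x x' minus by simp
      also have "\<dots> \<le> c * d" using x' r(2) by (intro mult_left_mono)
      finally show ?thesis using d by linarith
    qed
    moreover have "openin (seminorm_topology A P) ?T" "x \<in> ?T"
      using A.openin_ball[OF r(1) x(1) d(1)] A.diff_self[OF r(1) x(1)] x d by auto
    ultimately show "\<exists>T. openin (seminorm_topology A P) T \<and> x \<in> T \<and>
        T \<subseteq> {x \<in> carrier A. q (f x \<ominus>\<^bsub>B\<^esub> y) < e}" by blast
  qed
  have "openin (seminorm_topology A P) (f -` U \<inter> topspace (seminorm_topology A P))"
    if U: "U \<in> {{z \<in> carrier B. q (z \<ominus>\<^bsub>B\<^esub> y) < e} | q y e. q \<in> Q \<and> y \<in> carrier B \<and> 0 < e}" for U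
  proof -
    obtain q y e where q: "q \<in> Q" and y: "y \<in> carrier B"
      and U: "U = {z \<in> carrier B. q (z \<ominus>\<^bsub>B\<^esub> y) < e}"
      using U by blast
    have "f -` U \<inter> topspace (seminorm_topology A P) = {x \<in> carrier A. q (f x \<ominus>\<^bsub>B\<^esub> y) < e}"
      using f by (auto simp: A.topspace_seminorm_topology U)
    then show ?thesis using ball[OF q y] by simp
  qed
  moreover have "f ` topspace (seminorm_topology A P) \<subseteq> topspace (seminorm_topology B Q)"
    using f by (auto simp: A.topspace_seminorm_topology B.topspace_seminorm_topology)
  ultimately show ?thesis
    unfolding seminorm_topology_def[of B] continuous_on_generated_topo_iff
      topology_generated_by_topspace by blast
qed

section \<open>Automatic boundedness of multipliers in the complete case\<close>

lemma (in seminormed_algebra) group_seminorms: "group_seminorms A {q}"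
  by (intro group_seminorms.intro group_seminorms_axioms.intro M.abelian_group_axioms)
    (auto simp: triangle)

text \<open>Passes from convergence of Cauchy filters to convergence of Cauchy sequences, the form
  required by Baire's theorem. The value 0 of \<open>d\<close> off the carrier makes it nonnegative
  and symmetric on the whole type.\<close>

lemma (in seminormed_algebra) mcomplete_norm_metric:
  assumes definite: "\<And>x. \<lbrakk>x \<in> carrier A; q x = 0\<rbrakk> \<Longrightarrow> x = \<zero>"
    and complete: "complete_algebra A (seminorm_topology A {q})"
  defines "d \<equiv> \<lambda>x y. if x \<in> carrier A \<and> y \<in> carrier A then q (x \<ominus> y) else 0"
  shows "Metric_space (carrier A) d" and "Metric_space.mcomplete (carrier A) d"
proof -
  show metric: "Metric_space (carrier A) d"
  proof
    show "0 \<le> d x y" for x y by (simp add: d_def nonneg)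
    show "d x y = d y x" for x y by (simp add: d_def diff_commute)
    show "d x y = 0 \<longleftrightarrow> x = y" if "x \<in> carrier A" "y \<in> carrier A" for x y
      using that definite[of "x \<ominus> y"] by (auto simp: d_def minus_eq_zero_iff)
    show "d x z \<le> d x y + d y z" if "x \<in> carrier A" "y \<in> carrier A" "z \<in> carrier A" for x y z
      using that triangle_diff by (simp add: d_def)
  qed
  interpret Metric_space "carrier A" d by fact
  interpret G: group_seminorms A "{q}" by (rule group_seminorms)
  show mcomplete
    unfolding mcomplete_def
  proof (intro allI impI)
    fix \<sigma> :: "nat \<Rightarrow> 'a" assume \<sigma>: "MCauchy \<sigma>"
    then have closed: "\<sigma> n \<in> carrier A" for n by (auto simp: MCauchy_def)
    let ?F = "filtermap \<sigma> sequentially"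
    obtain l where l: "limitin (seminorm_topology A {q}) (\<lambda>x. x) l ?F"
    proof (rule G.complete_algebraD[OF complete])
      show "?F \<noteq> bot" by (simp add: filtermap_bot_iff)
      show "?F \<le> principal (carrier A)" by (simp add: le_principal eventually_filtermap closed)
      fix r e assume "r \<in> {q}" "0 < (e::real)"
      then obtain N where N: "\<And>m n. N \<le> m \<Longrightarrow> N \<le> n \<Longrightarrow> d (\<sigma> m) (\<sigma> n) < e"
        using \<sigma> unfolding MCauchy_def by blast
      \<comment> \<open>The tail of the sequence from N on is a small set belonging to the image
        filter.\<close>
      let ?Q = "\<lambda>x. \<exists>n\<ge>N. x = \<sigma> n"
      have "eventually ?Q ?F"
        unfolding eventually_filtermap eventually_sequentially by blast
      moreover have "x \<in> carrier A \<and> y \<in> carrier A \<and> r (x \<ominus> y) < e" if "?Q x" "?Q y" for x y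
        using that N \<open>r \<in> {q}\<close> closed by (fastforce simp: d_def)
      ultimately show "\<exists>Q. eventually Q ?F \<and>
          (\<forall>x y. Q x \<longrightarrow> Q y \<longrightarrow> x \<in> carrier A \<and> y \<in> carrier A \<and> r (x \<ominus> y) < e)"
        by (intro exI[of _ ?Q]) blast
    qed
    have "limitin mtopology \<sigma> l sequentially"
      using l closed unfolding limitin_metric G.limitin_seminorm_topology
      by (simp add: eventually_filtermap d_def)
    then show "\<exists>l. limitin mtopology \<sigma> l sequentially" ..
  qed
qed

lemma (in uniform_seminormed_algebra) multiplier_bounded:
  assumes definite: "\<And>x. \<lbrakk>x \<in> carrier A; q x = 0\<rbrakk> \<Longrightarrow> x = \<zero>"
    and complete: "complete_algebra A (seminorm_topology A {q})"
    and T: "T \<in> multipliers A"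
  obtains c where "0 \<le> c" "\<And>x. x \<in> carrier A \<Longrightarrow> q (T x) \<le> c * q x"
proof -
  interpret reduced_algebra A
    by unfold_locales (metis definite square zero power_eq_0_iff)
  define d where "d = (\<lambda>x y. if x \<in> carrier A \<and> y \<in> carrier A then q (x \<ominus> y) else 0)"
  interpret Met: Metric_space "carrier A" d
    unfolding d_def using definite complete by (rule mcomplete_norm_metric)
  have mcomplete: "Met.mcomplete"
    unfolding d_def using definite complete by (rule mcomplete_norm_metric)
  have in_mball: "y \<in> Met.mball x r \<longleftrightarrow> x \<in> carrier A \<and> y \<in> carrier A \<and> q (x \<ominus> y) < r" for x y r
    unfolding Met.in_mball by (auto simp: d_def)
  note TA = multipliers_closed[OF T]
  \<comment> \<open>If \<open>T\<close> is unbounded, these sets are open and dense. Their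
    intersection is empty, since no real number exceeds all naturals, and this contradicts Baire's
    theorem.\<close>
  let ?G = "\<lambda>n::nat. {x \<in> carrier A. real n < q (T x)}"
  have "\<exists>c\<ge>0. \<forall>x\<in>carrier A. q (T x) \<le> c * q x"
  proof (rule ccontr)
    assume "\<not> ?thesis"
    then have unbounded: "\<exists>x\<in>carrier A. c * q x < q (T x)" if "0 \<le> c" for c
      using that not_le by blast
    have "openin Met.mtopology (?G n)" for n
      unfolding Met.openin_mtopology
    proof (intro conjI allI impI)
      fix x assume "x \<in> ?G n"
      then have x: "x \<in> carrier A" "real n < q (T x)" by auto
      let ?a = "q (T x)" and ?b = "q (T (T x))"
      have a: "0 < ?a" using x by (simp add: order_le_less_trans[OF of_nat_0_le_iff])
      have b: "0 \<le> ?b" using x TA by (simp add: nonneg)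
      \<comment> \<open>Chosen so that r \<open>?b\<close> is smaller than (\<open>?a\<close> - n)
        \<open>?a\<close>, which leaves more than n \<open>?a\<close> for q(T y) \<open>?a\<close>.
        Adding 1 guards against \<open>?b\<close> = 0.\<close>
      define r where "r = (?a - real n) * ?a / (?b + 1)"
      have r: "0 < r" using a b x by (simp add: r_def)
      have "real n < q (T y)" if y: "y \<in> carrier A" "q (x \<ominus> y) < r" for y
      proof -
        let ?w = "T x"
        have w: "?w \<in> carrier A" using x TA by simp
        have eq: "?w \<otimes> ?w \<ominus> T y \<otimes> ?w = (x \<ominus> y) \<otimes> T ?w"
          using x y w TA by (simp add: mult_minus_left multipliers_mult[OF T])
        have "?a\<^sup>2 = q (?w \<otimes> ?w)" using w by (simp add: square)
        also have "\<dots> \<le> q (T y \<otimes> ?w) + q ((x \<ominus> y) \<otimes> T ?w)"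
          using diff_le[of "?w \<otimes> ?w" "T y \<otimes> ?w"] w x y TA by (simp add: eq mult_closed)
        also have "q (T y \<otimes> ?w) \<le> q (T y) * ?a" using w y TA by (simp add: submult)
        also have "q ((x \<ominus> y) \<otimes> T ?w) \<le> q (x \<ominus> y) * ?b" using w x y TA by (simp add: submult)
        also have "q (x \<ominus> y) * ?b \<le> r * ?b" using y b by (intro mult_right_mono) auto
        also have "r * ?b < (?a - real n) * ?a"
          using a b x by (simp add: r_def field_simps)
        finally have "real n * ?a < q (T y) * ?a"
          by (simp add: power2_eq_square algebra_simps)
        then show ?thesis using a by simp
      qed
      then have "Met.mball x r \<subseteq> ?G n" using in_mball by blast
      then show "\<exists>r>0. Met.mball x r \<subseteq> ?G n" using r by blast
    qed auto
    moreover have "Met.mtopology closure_of (?G n) = carrier A" for n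
    proof -
      have "\<exists>y\<in>?G n. y \<in> Met.mball x r" if x: "x \<in> carrier A" and r: "0 < r" for x r
      proof (cases "real n < q (T x)")
        case True
        then show ?thesis using x r in_mball[of x x r] by auto
      next
        case False
        \<comment> \<open>Rescaling z to norm r/2 uses the factor t = r/(2 q(z)). With this c one
          has t c q(z) = 2n + 1, so the rescaled vector has an image of norm greater than 2n +
          1.\<close>
        define c where "c = 2 * (2 * real n + 1) / r"
        have "0 \<le> c" using r by (simp add: c_def)
        then obtain z where z: "z \<in> carrier A" "c * q z < q (T z)" using unbounded by blast
        have "q z \<noteq> 0"
        proof
          assume "q z = 0"
          then have "z = \<zero>" using definite z by blast
          then have "T z = \<zero>" using multiplier_smult[OF T, of \<zero> 0] TA by simp
          then show False using z \<open>q z = 0\<close> by simp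
        qed
        then have qz: "0 < q z" using nonneg[OF z(1)] by simp
        define t where "t = r / (2 * q z)"
        have t: "0 < t" using qz r by (simp add: t_def)
        define w where "w = complex_of_real t \<odot> z"
        have w: "w \<in> carrier A" using z by (simp add: w_def)
        have qw: "q w = r / 2" using z qz t by (simp add: w_def scale) (simp add: t_def)
        have "2 * real n + 1 = t * (c * q z)" using qz r by (simp add: t_def c_def)
        also have "\<dots> < t * q (T z)" using z t by simp
        also have "\<dots> = q (T w)" using z t TA by (simp add: w_def multiplier_smult[OF T] scale)
        finally have Tw: "2 * real n + 1 < q (T w)" .
        have weq: "(x \<oplus> w) \<ominus> x = w" using x w by (simp add: M.minus_eq M.a_ac M.r_neg)
        then have "T w = T (x \<oplus> w) \<ominus> T x"
          using multiplier_minus[OF T, of "x \<oplus> w" x] x w by simp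
        then have "q (T w) \<le> q (T (x \<oplus> w)) + q (T x)"
          using triangle_diff[of "T (x \<oplus> w)" \<zero> "T x"] diff_commute[of \<zero> "T x"] x w TA by simp
        \<comment> \<open>In this case q(T x) is at most n, so a perturbation whose image exceeds 2n
          + 1 pushes the image of the sum beyond n.\<close>
        then have "x \<oplus> w \<in> ?G n" using False Tw x w by simp
        moreover have "x \<oplus> w \<in> Met.mball x r"
          unfolding in_mball using x w weq qw r diff_commute[of x "x \<oplus> w"] by simp
        ultimately show ?thesis by blast
      qed
      then show ?thesis unfolding Met.metric_closure_of by blast
    qed
    ultimately have "Met.mtopology closure_of (\<Inter>(range ?G)) = carrier A"
      by (intro Met.metric_Baire_category mcomplete) auto
    \<comment> \<open>The closure of the intersection contains zero, whereas the closure of the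
      empty set is empty.\<close>
    then have "\<Inter>(range ?G) \<noteq> {}" using M.zero_closed by (metis closure_of_empty empty_iff)
    then obtain x where "\<And>n::nat. real n < q (T x)" by blast
    then show False using reals_Archimedean2[of "q (T x)"] by (meson order_less_asym)
  qed
  then show thesis using that by blast
qed

section \<open>The projective limit\<close>

context uniform_topological_algebra
begin

abbreviation "fac \<alpha> \<equiv> factor_algebra A (p \<alpha>)"

abbreviation "pr \<alpha> \<equiv> factor_proj A (p \<alpha>)"

lemma factor: "\<alpha> \<in> \<Lambda> \<Longrightarrow> uniform_seminormed_algebra A (p \<alpha>)"
  using uniform complex_algebra_axioms
  by (simp add: uniform_seminormed_algebra_def seminormed_algebra_def seminormed_algebra_axioms_def
      uniform_seminormed_algebra_axioms_def uniform_seminorm_def)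

lemma seminormed: "\<alpha> \<in> \<Lambda> \<Longrightarrow> seminormed_algebra A (p \<alpha>)"
  using factor by (rule uniform_seminormed_algebra.axioms)

lemmas carrier_factor = seminormed_algebra.carrier_factor[OF seminormed]
  and mem_proj_iff = seminormed_algebra.mem_proj_iff[OF seminormed]
  and proj_eq_iff = seminormed_algebra.proj_eq_iff[OF seminormed]
  and proj_closed = seminormed_algebra.proj_closed[OF seminormed]
  and factor_add = seminormed_algebra.factor_add[OF seminormed]
  and factor_mult = seminormed_algebra.factor_mult[OF seminormed]
  and factor_smult = seminormed_algebra.factor_smult[OF seminormed]
  and factor_minus = seminormed_algebra.factor_minus[OF seminormed]
  and factor_norm_proj = seminormed_algebra.factor_norm_proj[OF seminormed]
  and factor_map_proj = seminormed_algebra.factor_map_proj[OF seminormed _ seminormed]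
  and complex_algebra_factor = seminormed_algebra.complex_algebra_factor[OF seminormed]
  and reduced_factor = uniform_seminormed_algebra.reduced_factor[OF factor]

lemma group_seminorms: "group_seminorms A (p ` \<Lambda>)"
  using nonempty seminormed
  by (intro group_seminorms.intro group_seminorms_axioms.intro M.abelian_group_axioms)
    (auto simp: seminormed_algebra.zero seminormed_algebra.triangle)

text \<open>If all seminorms vanish at x, then every open set around zero contains x, contrary to
  the Hausdorff property. A constant function along the principal filter of one point turns eventual
  membership into plain membership.\<close>

lemma eq_zero_if_seminorms_zero:
  assumes x: "x \<in> carrier A" and px: "\<And>\<alpha>. \<alpha> \<in> \<Lambda> \<Longrightarrow> p \<alpha> x = 0"
  shows "x = \<zero>"
proof (rule ccontr)
  assume "x \<noteq> \<zero>"
  then obtain U V where "openin \<tau> V" "\<zero> \<in> V" "x \<in> U" "U \<inter> V = {}"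
    using Hausdorff x M.zero_closed topspace_eq unfolding Hausdorff_space_def disjnt_def by metis
  moreover have "\<forall>\<^sub>F z in principal {()}. x \<in> V"
    using \<open>openin \<tau> V\<close> \<open>\<zero> \<in> V\<close> x px unfolding topology_eq
    by (intro group_seminorms.eventually_in_open[OF group_seminorms, of V \<zero> "\<lambda>_. x"]) auto
  ultimately show False by (auto simp: eventually_principal)
qed

lemma reduced: "reduced_algebra A"
proof
  fix x assume x: "x \<in> carrier A" "x \<otimes> x = \<zero>"
  have "p \<alpha> x = 0" if "\<alpha> \<in> \<Lambda>" for \<alpha>
    using uniform_seminormed_algebra.square[OF factor[OF that], of x]
      seminormed_algebra.zero[OF seminormed[OF that]] x by simp
  then show "x = \<zero>" using x eq_zero_if_seminorms_zero by blast
qed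

lemma eq_if_proj_eq:
  assumes "x \<in> carrier A" "y \<in> carrier A" "\<And>\<alpha>. \<alpha> \<in> \<Lambda> \<Longrightarrow> pr \<alpha> x = pr \<alpha> y"
  shows "x = y"
proof -
  have "x \<ominus> y = \<zero>"
    using assms by (intro eq_zero_if_seminorms_zero) (simp_all add: proj_eq_iff)
  then show ?thesis using assms by (simp add: minus_eq_zero_iff)
qed

lemma factor_exhaust:
  assumes "\<alpha> \<in> \<Lambda>" "C \<in> carrier (fac \<alpha>)"
  obtains x where "x \<in> carrier A" "C = pr \<alpha> x"
  using assms carrier_factor by blast

section \<open>The homomorphism into the projective limit\<close>

context
  fixes \<alpha> T assumes \<alpha>: "\<alpha> \<in> \<Lambda>" and T: "T \<in> multipliers A"
begin

lemma factor_multiplier: "factor_multiplier A (p \<alpha>) T \<in> multipliers (fac \<alpha>)"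
  and factor_multiplier_proj:
    "x \<in> carrier A \<Longrightarrow> factor_multiplier A (p \<alpha>) T (pr \<alpha> x) = pr \<alpha> (T x)"
  unfolding factor_multiplier_def
  using induced_multiplier[OF complex_algebra_axioms reduced_factor[OF \<alpha>] T]
    induced_multiplier_apply[OF complex_algebra_axioms reduced_factor[OF \<alpha>] T]
    carrier_factor[OF \<alpha>] factor_minus[OF \<alpha>] factor_mult[OF \<alpha>]
  by simp_all

end

lemma factor_multiplier_eqI:
  assumes "\<alpha> \<in> \<Lambda>" "V \<in> multipliers (fac \<alpha>)" "\<And>x. x \<in> carrier A \<Longrightarrow> V (pr \<alpha> x) = pr \<alpha> (T x)"
  shows "factor_multiplier A (p \<alpha>) T = V"
  unfolding factor_multiplier_def using assms
  by (intro induced_multiplier_eqI) (simp_all add: carrier_factor)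

lemma factor_map_image:
  assumes "\<alpha> \<in> \<Lambda>" "\<beta> \<in> \<Lambda>" "seminorm_le A (p \<alpha>) (p \<beta>)"
  shows "factor_map A (p \<alpha>) (p \<beta>) ` carrier (fac \<beta>) = carrier (fac \<alpha>)"
  using assms by (simp add: carrier_factor image_image factor_map_proj cong: image_cong)

text \<open>The class of x for the smaller seminorm is the image of its class for the larger one, so
  this is the defining equation of the induced multiplier read on representatives.\<close>

lemma connecting_map_proj:
  assumes \<alpha>: "\<alpha> \<in> \<Lambda>" and \<beta>: "\<beta> \<in> \<Lambda>" and le: "seminorm_le A (p \<alpha>) (p \<beta>)"
    and U: "U \<in> multipliers (fac \<beta>)" and x: "x \<in> carrier A"
  shows "connecting_map A (p \<alpha>) (p \<beta>) U (pr \<alpha> x) = factor_map A (p \<alpha>) (p \<beta>) (U (pr \<beta> x))"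
proof -
  let ?f = "factor_map A (p \<alpha>) (p \<beta>)"
  have "connecting_map A (p \<alpha>) (p \<beta>) U (?f (pr \<beta> x)) = ?f (U (pr \<beta> x))"
    unfolding connecting_map_def
  proof (rule induced_multiplier_apply[OF complex_algebra_factor[OF \<beta>] reduced_factor[OF \<alpha>] U])
    fix C D assume "C \<in> carrier (fac \<beta>)" "D \<in> carrier (fac \<beta>)"
    then obtain x y where x: "x \<in> carrier A" "C = pr \<beta> x" and y: "y \<in> carrier A" "D = pr \<beta> y"
      using factor_exhaust[OF \<beta>] by metis
    show "?f (C \<ominus>\<^bsub>fac \<beta>\<^esub> D) = ?f C \<ominus>\<^bsub>fac \<alpha>\<^esub> ?f D"
      using x y \<alpha> \<beta> le by (simp add: factor_minus factor_map_proj)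
    show "?f (C \<otimes>\<^bsub>fac \<beta>\<^esub> D) = ?f C \<otimes>\<^bsub>fac \<alpha>\<^esub> ?f D"
      using x y \<alpha> \<beta> le by (simp add: factor_mult factor_map_proj mult_closed)
  qed (use \<alpha> \<beta> le x in \<open>simp_all add: factor_map_image proj_closed\<close>)
  then show ?thesis using \<alpha> \<beta> le x by (simp add: factor_map_proj)
qed

abbreviation "L \<equiv> limit_multiplier_algebra A \<Lambda> p"

text \<open>This is the isomorphism \<phi>, sending T to the family of its induced multipliers. The
  restriction to \<open>\<Lambda>\<close> matches the extensional functions in the carrier of the
  limit.\<close>

definition to_limit :: "('a \<Rightarrow> 'a) \<Rightarrow> 'i \<Rightarrow> 'a set \<Rightarrow> 'a set" where
  "to_limit T = (\<lambda>\<alpha>\<in>\<Lambda>. factor_multiplier A (p \<alpha>) T)"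

lemma carrier_limit:
  "carrier L = {u \<in> \<Pi>\<^sub>E \<alpha>\<in>\<Lambda>. multipliers (fac \<alpha>). \<forall>\<alpha>\<in>\<Lambda>. \<forall>\<beta>\<in>\<Lambda>.
     seminorm_le A (p \<alpha>) (p \<beta>) \<longrightarrow> connecting_map A (p \<alpha>) (p \<beta>) (u \<beta>) = u \<alpha>}"
  by (simp add: limit_multiplier_algebra_def projective_limit_def multiplier_algebra_def)

text \<open>Compatibility comes from uniqueness: the multiplier induced by \<open>T\<close> on the
  smaller factor already satisfies the equation that characterises the image under the connecting
  map.\<close>

lemma to_limit_closed:
  assumes T: "T \<in> multipliers A"
  shows "to_limit T \<in> carrier L"
proof -
  have "connecting_map A (p \<alpha>) (p \<beta>) (factor_multiplier A (p \<beta>) T) = factor_multiplier A (p \<alpha>) T"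
    if \<alpha>: "\<alpha> \<in> \<Lambda>" and \<beta>: "\<beta> \<in> \<Lambda>" and le: "seminorm_le A (p \<alpha>) (p \<beta>)" for \<alpha> \<beta>
    unfolding connecting_map_def
  proof (rule induced_multiplier_eqI)
    fix C assume "C \<in> carrier (fac \<beta>)"
    then obtain x where "x \<in> carrier A" "C = pr \<beta> x" using factor_exhaust[OF \<beta>] by metis
    then show "factor_multiplier A (p \<alpha>) T (factor_map A (p \<alpha>) (p \<beta>) C) =
        factor_map A (p \<alpha>) (p \<beta>) (factor_multiplier A (p \<beta>) T C)"
      using \<alpha> \<beta> le T by (simp add: factor_map_proj factor_multiplier_proj multipliers_closed)
  qed (use \<alpha> \<beta> le T in \<open>simp_all add: factor_map_image factor_multiplier\<close>)
  then show ?thesis using T by (simp add: carrier_limit to_limit_def factor_multiplier)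
qed

lemma to_limit_inj: "inj_on to_limit (multipliers A)"
proof (rule inj_onI)
  fix S T assume S: "S \<in> multipliers A" and T: "T \<in> multipliers A" and eq: "to_limit S = to_limit T"
  show "S = T"
  proof (rule multipliers_ext[OF S T], rule eq_if_proj_eq)
    fix x \<alpha> assume "x \<in> carrier A" "\<alpha> \<in> \<Lambda>"
    moreover have "factor_multiplier A (p \<alpha>) S = factor_multiplier A (p \<alpha>) T"
      using fun_cong[OF eq, of \<alpha>] \<open>\<alpha> \<in> \<Lambda>\<close> by (simp add: to_limit_def)
    ultimately show "pr \<alpha> (S x) = pr \<alpha> (T x)"
      using S T by (simp flip: factor_multiplier_proj)
  qed (use S T in \<open>simp_all add: multipliers_closed\<close>)
qed

text \<open>The cosets \<open>u \<alpha> (x + ker (p \<alpha>))\<close> form a filter base which is Cauchy, and its limit lies in all of them.\<close>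

lemma limit_point:
  assumes complete: "complete_algebra A \<tau>" and u: "u \<in> carrier L" and x: "x \<in> carrier A"
  obtains y where "y \<in> carrier A" "\<And>\<alpha>. \<alpha> \<in> \<Lambda> \<Longrightarrow> u \<alpha> (pr \<alpha> x) = pr \<alpha> y"
proof -
  interpret G: group_seminorms A "p ` \<Lambda>" by (rule group_seminorms)
  define C where "C \<alpha> = u \<alpha> (pr \<alpha> x)" for \<alpha>
  have um: "u \<alpha> \<in> multipliers (fac \<alpha>)" if "\<alpha> \<in> \<Lambda>" for \<alpha>
    using u that by (auto simp: carrier_limit)
  have C: "C \<alpha> \<in> carrier (fac \<alpha>)" if "\<alpha> \<in> \<Lambda>" for \<alpha>
    unfolding C_def using that x by (intro multipliers_closed[OF um] proj_closed)
  have memC: "a \<in> C \<alpha> \<longleftrightarrow> a \<in> carrier A \<and> pr \<alpha> a = C \<alpha>" if "\<alpha> \<in> \<Lambda>" for \<alpha> a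
    using factor_exhaust[OF that C[OF that]] mem_proj_iff[OF that] by metis
  \<comment> \<open>Compatibility of the family becomes inclusion of cosets: a larger seminorm has a
    smaller coset. With directedness this yields a filter base.\<close>
  have mono: "C \<beta> \<subseteq> C \<alpha>" if \<alpha>: "\<alpha> \<in> \<Lambda>" and \<beta>: "\<beta> \<in> \<Lambda>" and le: "seminorm_le A (p \<alpha>) (p \<beta>)" for \<alpha> \<beta>
  proof
    fix a assume "a \<in> C \<beta>"
    then have a: "a \<in> carrier A" "pr \<beta> a = C \<beta>" using memC[OF \<beta>] by auto
    have "connecting_map A (p \<alpha>) (p \<beta>) (u \<beta>) = u \<alpha>"
      using u that by (simp add: carrier_limit)
    then have "C \<alpha> = factor_map A (p \<alpha>) (p \<beta>) (C \<beta>)"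
      using connecting_map_proj[OF that um[OF \<beta>] x] by (simp add: C_def)
    also have "\<dots> = pr \<alpha> a" using a that by (simp add: factor_map_proj flip: a(2))
    finally show "a \<in> C \<alpha>" using a memC[OF \<alpha>] by simp
  qed
  define F where "F = (INF \<alpha>\<in>\<Lambda>. principal (C \<alpha>))"
  have evF: "eventually P F \<longleftrightarrow> (\<exists>\<alpha>\<in>\<Lambda>. \<forall>a\<in>C \<alpha>. P a)" for P
    unfolding F_def
  proof (subst eventually_INF_base)
    fix \<alpha> \<beta> assume "\<alpha> \<in> \<Lambda>" "\<beta> \<in> \<Lambda>"
    then obtain \<gamma> where "\<gamma> \<in> \<Lambda>" "C \<gamma> \<subseteq> C \<alpha>" "C \<gamma> \<subseteq> C \<beta>" using directed mono by meson
    then show "\<exists>\<gamma>\<in>\<Lambda>. principal (C \<gamma>) \<le> inf (principal (C \<alpha>)) (principal (C \<beta>))" by auto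
  qed (use nonempty in \<open>simp_all add: eventually_principal\<close>)
  have nonbot: "F \<noteq> bot"
  proof -
    have "C \<alpha> \<noteq> {}" if "\<alpha> \<in> \<Lambda>" for \<alpha>
      using factor_exhaust[OF that C[OF that]] memC[OF that] by (metis empty_iff)
    then show ?thesis unfolding trivial_limit_def evF by blast
  qed
  obtain l where l: "limitin (seminorm_topology A (p ` \<Lambda>)) (\<lambda>x. x) l F"
  proof (rule G.complete_algebraD[OF complete[unfolded topology_eq] nonbot])
    show "F \<le> principal (carrier A)"
      unfolding le_principal evF using nonempty memC by blast
    fix q e assume "q \<in> p ` \<Lambda>" "0 < (e::real)"
    then obtain \<alpha> where \<alpha>: "\<alpha> \<in> \<Lambda>" "q = p \<alpha>" by blast
    \<comment> \<open>Two points of the same coset are at distance exactly 0 in its seminorm, so one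
      coset serves for every e.\<close>
    have "a \<in> carrier A \<and> b \<in> carrier A \<and> q (a \<ominus> b) < e" if "a \<in> C \<alpha>" "b \<in> C \<alpha>" for a b
    proof -
      have ab: "a \<in> carrier A" "b \<in> carrier A" "pr \<alpha> a = pr \<alpha> b"
        using that memC[OF \<alpha>(1)] by auto
      then have "q (a \<ominus> b) = 0" using proj_eq_iff \<alpha> by blast
      then show ?thesis using ab \<open>0 < e\<close> by simp
    qed
    moreover have "\<forall>\<^sub>F a in F. a \<in> C \<alpha>" using evF \<alpha> by blast
    ultimately show "\<exists>Q. eventually Q F \<and>
        (\<forall>x y. Q x \<longrightarrow> Q y \<longrightarrow> x \<in> carrier A \<and> y \<in> carrier A \<and> q (x \<ominus> y) < e)"
      by (intro exI[of _ "\<lambda>a. a \<in> C \<alpha>"]) blast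
  qed
  have lA: "l \<in> carrier A" using l by (simp add: G.limitin_seminorm_topology)
  have "C \<alpha> = pr \<alpha> l" if \<alpha>: "\<alpha> \<in> \<Lambda>" for \<alpha>
  proof -
    interpret p: uniform_seminormed_algebra A "p \<alpha>" using factor \<alpha> .
    obtain y where y: "y \<in> carrier A" "C \<alpha> = pr \<alpha> y" using factor_exhaust[OF \<alpha> C[OF \<alpha>]] .
    \<comment> \<open>A point a of the coset that is e-close to l is at distance 0 from the
      representative y; hence y is e-close to l for every positive e.\<close>
    have "p \<alpha> (y \<ominus> l) \<le> 0"
    proof (rule field_le_epsilon)
      fix e :: real assume "0 < e"
      then have "\<forall>\<^sub>F a in F. a \<in> carrier A \<and> p \<alpha> (a \<ominus> l) < e"
        using l \<alpha> unfolding G.limitin_seminorm_topology by blast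
      moreover have "\<forall>\<^sub>F a in F. a \<in> C \<alpha>" using evF \<alpha> by blast
      ultimately have "\<forall>\<^sub>F a in F. (a \<in> carrier A \<and> p \<alpha> (a \<ominus> l) < e) \<and> a \<in> C \<alpha>" by (rule eventually_conj)
      then obtain a where a: "p \<alpha> (a \<ominus> l) < e" "a \<in> C \<alpha>"
        using nonbot eventually_happens by fast
      then have "a \<in> carrier A" "p \<alpha> (y \<ominus> a) = 0"
        using memC[OF \<alpha>] y proj_eq_iff[OF \<alpha>, of y a] by simp_all
      then show "p \<alpha> (y \<ominus> l) \<le> 0 + e"
        using p.triangle_diff[of y a l] y a lA by simp
    qed
    then have "p \<alpha> (y \<ominus> l) = 0" using p.nonneg[of "y \<ominus> l"] y lA by simp
    then show ?thesis using y lA \<alpha> by (simp add: proj_eq_iff)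
  qed
  then show thesis using that lA by (simp add: C_def)
qed

text \<open>The limit points are chosen separately for each x. The multiplier identity for the
  resulting map holds in every factor, and the factors separate points.\<close>

lemma to_limit_surj:
  assumes complete: "complete_algebra A \<tau>" and u: "u \<in> carrier L"
  shows "u \<in> to_limit ` multipliers A"
proof -
  have um: "u \<alpha> \<in> multipliers (fac \<alpha>)" if "\<alpha> \<in> \<Lambda>" for \<alpha>
    using u that by (auto simp: carrier_limit)
  have "\<forall>x\<in>carrier A. \<exists>y. y \<in> carrier A \<and> (\<forall>\<alpha>\<in>\<Lambda>. u \<alpha> (pr \<alpha> x) = pr \<alpha> y)"
    using limit_point[OF complete u] by metis
  then obtain t where t: "\<And>x. x \<in> carrier A \<Longrightarrow> t x \<in> carrier A"
    and ut: "\<And>x \<alpha>. \<lbrakk>x \<in> carrier A; \<alpha> \<in> \<Lambda>\<rbrakk> \<Longrightarrow> u \<alpha> (pr \<alpha> x) = pr \<alpha> (t x)"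
    by metis
  let ?T = "restrict t (carrier A)"
  have T: "?T \<in> multipliers A"
    unfolding multipliers_def
  proof (intro CollectI conjI ballI)
    fix x y assume xy: "x \<in> carrier A" "y \<in> carrier A"
    show "?T x \<otimes> y = x \<otimes> ?T y"
    proof (rule eq_if_proj_eq)
      fix \<alpha> assume \<alpha>: "\<alpha> \<in> \<Lambda>"
      have "u \<alpha> (pr \<alpha> x) \<otimes>\<^bsub>fac \<alpha>\<^esub> pr \<alpha> y = pr \<alpha> x \<otimes>\<^bsub>fac \<alpha>\<^esub> u \<alpha> (pr \<alpha> y)"
        using um \<alpha> xy by (intro multipliers_mult) (simp_all add: proj_closed)
      then show "pr \<alpha> (?T x \<otimes> y) = pr \<alpha> (x \<otimes> ?T y)"
        using xy t ut \<alpha> by (simp add: factor_mult)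
    qed (use xy t in \<open>simp_all add: mult_closed\<close>)
  qed (use t in simp)
  have "to_limit ?T = u"
  proof
    fix \<alpha>
    show "to_limit ?T \<alpha> = u \<alpha>"
    proof (cases "\<alpha> \<in> \<Lambda>")
      case True
      then show ?thesis
        using um ut by (auto simp: to_limit_def intro: factor_multiplier_eqI)
    next
      case False
      then show ?thesis using u by (auto simp: to_limit_def carrier_limit PiE_def extensional_def)
    qed
  qed
  then show ?thesis using T by blast
qed

text \<open>The right-hand side is a multiplier of the factor with the required values on classes,
  so uniqueness applies. The rules for products and scalars have the same proof.\<close>

lemma factor_multiplier_add:
  assumes "\<alpha> \<in> \<Lambda>" "S \<in> multipliers A" "T \<in> multipliers A"
  shows "factor_multiplier A (p \<alpha>) (S \<oplus>\<^bsub>multiplier_algebra A\<^esub> T) =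
    factor_multiplier A (p \<alpha>) S \<oplus>\<^bsub>multiplier_algebra (fac \<alpha>)\<^esub> factor_multiplier A (p \<alpha>) T"
  using assms complex_algebra.add_multiplier[OF complex_algebra_factor]
  by (intro factor_multiplier_eqI)
    (simp_all add: multiplier_algebra_def factor_multiplier factor_multiplier_proj
      factor_add proj_closed multipliers_closed)

lemma factor_multiplier_mult:
  assumes "\<alpha> \<in> \<Lambda>" "S \<in> multipliers A" "T \<in> multipliers A"
  shows "factor_multiplier A (p \<alpha>) (S \<otimes>\<^bsub>multiplier_algebra A\<^esub> T) =
    factor_multiplier A (p \<alpha>) S \<otimes>\<^bsub>multiplier_algebra (fac \<alpha>)\<^esub> factor_multiplier A (p \<alpha>) T"
  using assms reduced_algebra.compose_multiplier[OF reduced_factor]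
  by (intro factor_multiplier_eqI)
    (simp_all add: multiplier_algebra_def factor_multiplier factor_multiplier_proj
      compose_eq proj_closed multipliers_closed)

lemma factor_multiplier_smult:
  assumes "\<alpha> \<in> \<Lambda>" "T \<in> multipliers A"
  shows "factor_multiplier A (p \<alpha>) (c \<odot>\<^bsub>multiplier_algebra A\<^esub> T) =
    c \<odot>\<^bsub>multiplier_algebra (fac \<alpha>)\<^esub> factor_multiplier A (p \<alpha>) T"
  using assms complex_algebra.smult_multiplier[OF complex_algebra_factor]
  by (intro factor_multiplier_eqI)
    (simp_all add: multiplier_algebra_def factor_multiplier factor_multiplier_proj
      factor_smult proj_closed multipliers_closed)

lemma to_limit_iso:
  assumes "complete_algebra A \<tau>"
  shows "to_limit \<in> algebra_iso (multiplier_algebra A) L"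
proof -
  have "bij_betw to_limit (multipliers A) (carrier L)"
    unfolding bij_betw_def using to_limit_inj to_limit_closed to_limit_surj[OF assms] by blast
  then show ?thesis
    by (simp add: algebra_iso_def multiplier_algebra_def[of A, THEN arg_cong[of _ _ carrier]]
        limit_multiplier_algebra_def projective_limit_def to_limit_def
        factor_multiplier_add factor_multiplier_mult factor_multiplier_smult cong: restrict_cong)
qed

section \<open>Topological statements for complete factors\<close>

context
  assumes complete_factors: "\<And>\<alpha>. \<alpha> \<in> \<Lambda> \<Longrightarrow>
    complete_algebra (fac \<alpha>) (seminorm_topology (fac \<alpha>) {factor_norm (p \<alpha>)})"
begin

lemma factor_multiplier_bounded:
  assumes \<alpha>: "\<alpha> \<in> \<Lambda>" and V: "V \<in> multipliers (fac \<alpha>)"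
  obtains c where "0 \<le> c"
    "\<And>z. z \<in> carrier (fac \<alpha>) \<Longrightarrow> factor_norm (p \<alpha>) (V z) \<le> c * factor_norm (p \<alpha>) z"
proof -
  interpret F: uniform_seminormed_algebra "fac \<alpha>" "factor_norm (p \<alpha>)"
    using factor[OF \<alpha>] by (rule uniform_seminormed_algebra.uniform_factor)
  show thesis
    using F.multiplier_bounded[OF _ complete_factors[OF \<alpha>] V] that
      seminormed_algebra.factor_norm_eq_zero_iff[OF seminormed[OF \<alpha>]] by blast
qed

text \<open>The bound for the multiplier induced on each factor, evaluated at the class of x, is a
  bound of p(T x) by a multiple of p(x) for the same seminorm p.\<close>

lemma multiplier_continuous:
  assumes T: "T \<in> multipliers A"
  shows "continuous_map \<tau> \<tau> T"
  unfolding topology_eq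
proof (rule continuous_map_seminorm_topology[OF group_seminorms group_seminorms])
  fix q assume "q \<in> p ` \<Lambda>"
  then obtain \<alpha> where \<alpha>: "\<alpha> \<in> \<Lambda>" "q = p \<alpha>" by blast
  obtain c where c: "0 \<le> c" "\<And>z. z \<in> carrier (fac \<alpha>) \<Longrightarrow>
      factor_norm (p \<alpha>) (factor_multiplier A (p \<alpha>) T z) \<le> c * factor_norm (p \<alpha>) z"
    using factor_multiplier_bounded[OF \<alpha>(1) factor_multiplier[OF \<alpha>(1) T]] by blast
  have "q (T x) \<le> c * q x" if "x \<in> carrier A" for x
    using c(2)[of "pr \<alpha> x"] that \<alpha> T
    by (simp add: factor_multiplier_proj factor_norm_proj proj_closed multipliers_closed)
  then show "\<exists>r\<in>p ` \<Lambda>. \<exists>c\<ge>0. \<forall>x\<in>carrier A. q (T x) \<le> c * r x"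
    using \<alpha> c(1) by blast
qed (use T in \<open>simp_all add: multipliers_closed reduced_algebra.multiplier_minus[OF reduced]\<close>)

text \<open>A real supremum is an upper bound only of a set bounded above; boundedness of
  \<open>V\<close> supplies this.\<close>

lemma factor_opnorm_upper:
  assumes \<alpha>: "\<alpha> \<in> \<Lambda>" and V: "V \<in> multipliers (fac \<alpha>)"
    and z: "z \<in> carrier (fac \<alpha>)" "factor_norm (p \<alpha>) z \<le> 1"
  shows "factor_norm (p \<alpha>) (V z) \<le> factor_opnorm A (p \<alpha>) V"
proof -
  obtain c where c: "0 \<le> c"
    "\<And>z. z \<in> carrier (fac \<alpha>) \<Longrightarrow> factor_norm (p \<alpha>) (V z) \<le> c * factor_norm (p \<alpha>) z"
    using factor_multiplier_bounded[OF \<alpha> V] by blast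
  have "factor_norm (p \<alpha>) (V w) \<le> c" if "w \<in> carrier (fac \<alpha>)" "factor_norm (p \<alpha>) w \<le> 1" for w
    using order_trans[OF c(2) mult_left_mono[OF that(2) c(1)]] that by simp
  then show ?thesis
    unfolding factor_opnorm_def using z by (intro cSup_upper bdd_aboveI[of _ c]) auto
qed

lemma factor_opnorm_least:
  assumes "\<alpha> \<in> \<Lambda>"
    and "\<And>z. \<lbrakk>z \<in> carrier (fac \<alpha>); factor_norm (p \<alpha>) z \<le> 1\<rbrakk> \<Longrightarrow> factor_norm (p \<alpha>) (V z) \<le> b"
  shows "factor_opnorm A (p \<alpha>) V \<le> b"
  unfolding factor_opnorm_def
proof (rule cSup_least)
  \<comment> \<open>The class of zero lies in the unit ball, so the supremum is over a nonempty
    set.\<close>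
  have "factor_norm (p \<alpha>) (pr \<alpha> \<zero>) = 0"
    using seminormed_algebra.zero[OF seminormed] assms(1) by (simp add: factor_norm_proj)
  then show "{factor_norm (p \<alpha>) (V z) |z. z \<in> carrier (fac \<alpha>) \<and> factor_norm (p \<alpha>) z \<le> 1} \<noteq> {}"
    using proj_closed[OF assms(1) M.zero_closed] by (auto intro!: exI[of _ "pr \<alpha> \<zero>"])
qed (use assms(2) in auto)

lemma group_seminorms_opnorm:
  assumes \<alpha>: "\<alpha> \<in> \<Lambda>"
  shows "group_seminorms (multiplier_algebra (fac \<alpha>)) {factor_opnorm A (p \<alpha>)}"
proof -
  interpret F: seminormed_algebra "fac \<alpha>" "factor_norm (p \<alpha>)"
    using seminormed[OF \<alpha>] by (rule seminormed_algebra.seminormed_factor)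
  have zero: "factor_opnorm A (p \<alpha>) (\<lambda>z\<in>carrier (fac \<alpha>). \<zero>\<^bsub>fac \<alpha>\<^esub>) = 0"
  proof (rule antisym)
    show "factor_opnorm A (p \<alpha>) (\<lambda>z\<in>carrier (fac \<alpha>). \<zero>\<^bsub>fac \<alpha>\<^esub>) \<le> 0"
      using \<alpha> by (intro factor_opnorm_least) simp_all
    show "0 \<le> factor_opnorm A (p \<alpha>) (\<lambda>z\<in>carrier (fac \<alpha>). \<zero>\<^bsub>fac \<alpha>\<^esub>)"
      using factor_opnorm_upper[OF \<alpha> F.zero_multiplier, of "\<zero>\<^bsub>fac \<alpha>\<^esub>"] by simp
  qed
  have add: "factor_opnorm A (p \<alpha>) (\<lambda>z\<in>carrier (fac \<alpha>). V z \<oplus>\<^bsub>fac \<alpha>\<^esub> W z) \<le>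
      factor_opnorm A (p \<alpha>) V + factor_opnorm A (p \<alpha>) W"
    if V: "V \<in> multipliers (fac \<alpha>)" and W: "W \<in> multipliers (fac \<alpha>)" for V W
  proof (rule factor_opnorm_least[OF \<alpha>])
    fix z assume z: "z \<in> carrier (fac \<alpha>)" "factor_norm (p \<alpha>) z \<le> 1"
    have "factor_norm (p \<alpha>) (V z \<oplus>\<^bsub>fac \<alpha>\<^esub> W z) \<le> factor_norm (p \<alpha>) (V z) + factor_norm (p \<alpha>) (W z)"
      using V W z by (intro F.triangle) (simp_all add: multipliers_closed)
    then show "factor_norm (p \<alpha>) ((\<lambda>z\<in>carrier (fac \<alpha>). V z \<oplus>\<^bsub>fac \<alpha>\<^esub> W z) z) \<le>
        factor_opnorm A (p \<alpha>) V + factor_opnorm A (p \<alpha>) W"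
      using factor_opnorm_upper[OF \<alpha> V z] factor_opnorm_upper[OF \<alpha> W z] z by simp
  qed
  show ?thesis
    by (intro group_seminorms.intro group_seminorms_axioms.intro F.abelian_group_multiplier_algebra)
      (auto simp: multiplier_algebra_def zero add)
qed

lemma factor_multiplier_minus:
  assumes "\<alpha> \<in> \<Lambda>" "S \<in> multipliers A" "T \<in> multipliers A"
  shows "factor_multiplier A (p \<alpha>) (S \<ominus>\<^bsub>multiplier_algebra A\<^esub> T) =
    factor_multiplier A (p \<alpha>) S \<ominus>\<^bsub>multiplier_algebra (fac \<alpha>)\<^esub> factor_multiplier A (p \<alpha>) T"
  by (rule abelian_group_hom_minus[OF abelian_group_multiplier_algebra
        complex_algebra.abelian_group_multiplier_algebra[OF complex_algebra_factor[OF assms(1)]]])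
    (use assms factor_multiplier factor_multiplier_add in simp_all)

lemma group_seminorms_multiplier:
  "group_seminorms (multiplier_algebra A) ((\<lambda>\<alpha>. multiplier_seminorm A (p \<alpha>)) ` \<Lambda>)"
proof (intro group_seminorms.intro group_seminorms_axioms.intro abelian_group_multiplier_algebra)
  fix q assume "q \<in> (\<lambda>\<alpha>. multiplier_seminorm A (p \<alpha>)) ` \<Lambda>"
  then obtain \<alpha> where \<alpha>: "\<alpha> \<in> \<Lambda>" and q: "q = multiplier_seminorm A (p \<alpha>)" by blast
  interpret F: group_seminorms "multiplier_algebra (fac \<alpha>)" "{factor_opnorm A (p \<alpha>)}"
    using \<alpha> by (rule group_seminorms_opnorm)
  interpret E: abelian_group "multiplier_algebra A" by (rule abelian_group_multiplier_algebra)
  let ?Z = "\<zero>\<^bsub>multiplier_algebra A\<^esub>"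
  have Z: "?Z \<in> multipliers A" using E.zero_closed by simp
  \<comment> \<open>Zero is written as \<open>?Z\<close> minus itself, and subtraction is already
    known to be preserved.\<close>
  have "factor_multiplier A (p \<alpha>) ?Z = \<zero>\<^bsub>multiplier_algebra (fac \<alpha>)\<^esub>"
    using factor_multiplier_minus[OF \<alpha> Z Z] factor_multiplier[OF \<alpha> Z] Z
    by (simp add: E.minus_eq E.r_neg F.minus_eq F.r_neg)
  then show "q ?Z = 0" by (simp add: q multiplier_seminorm_def F.zero)
  fix S T assume "S \<in> carrier (multiplier_algebra A)" "T \<in> carrier (multiplier_algebra A)"
  then have "S \<in> multipliers A" "T \<in> multipliers A" by simp_all
  then show "q (S \<oplus>\<^bsub>multiplier_algebra A\<^esub> T) \<le> q S + q T"
    using \<alpha> F.triangle[of "factor_opnorm A (p \<alpha>)"]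
    by (simp add: q multiplier_seminorm_def factor_multiplier_add factor_multiplier)
qed (use nonempty in auto)

abbreviation "opnorm_topology \<alpha> \<equiv>
  seminorm_topology (multiplier_algebra (fac \<alpha>)) {factor_opnorm A (p \<alpha>)}"

lemma topspace_multiplier_topology: "topspace (multiplier_topology A \<Lambda> p) = multipliers A"
  unfolding multiplier_topology_def
  using group_seminorms.topspace_seminorm_topology[OF group_seminorms_multiplier]
  by simp

lemma topspace_opnorm_topology: "\<alpha> \<in> \<Lambda> \<Longrightarrow> topspace (opnorm_topology \<alpha>) = multipliers (fac \<alpha>)"
  using group_seminorms.topspace_seminorm_topology[OF group_seminorms_opnorm]
  by simp

lemma topspace_limit_topology: "topspace (limit_multiplier_topology A \<Lambda> p) = carrier L"
  unfolding limit_multiplier_topology_def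
  by (auto simp: topspace_opnorm_topology PiE_iff carrier_limit extensional_def)

text \<open>Continuity is checked in each coordinate. There the operator norm of the image is by
  definition the seminorm of T, so the bound holds with constant 1.\<close>

lemma to_limit_continuous:
  "continuous_map (multiplier_topology A \<Lambda> p) (limit_multiplier_topology A \<Lambda> p) to_limit"
  unfolding limit_multiplier_topology_def continuous_map_in_subtopology continuous_map_componentwise
proof (intro conjI ballI)
  fix \<alpha> assume \<alpha>: "\<alpha> \<in> \<Lambda>"
  have "continuous_map (multiplier_topology A \<Lambda> p) (opnorm_topology \<alpha>) (factor_multiplier A (p \<alpha>))"
    unfolding multiplier_topology_def
  proof (rule continuous_map_seminorm_topology[OF group_seminorms_multiplier group_seminorms_opnorm[OF \<alpha>]])
    fix q assume "q \<in> {factor_opnorm A (p \<alpha>)}"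
    then show "\<exists>r\<in>(\<lambda>\<alpha>. multiplier_seminorm A (p \<alpha>)) ` \<Lambda>. \<exists>c\<ge>0.
        \<forall>T\<in>carrier (multiplier_algebra A). q (factor_multiplier A (p \<alpha>) T) \<le> c * r T"
      using \<alpha> by (auto simp: multiplier_seminorm_def intro!: bexI[of _ \<alpha>] exI[of _ 1])
  next
    fix S T assume "S \<in> carrier (multiplier_algebra A)" "T \<in> carrier (multiplier_algebra A)"
    then have "S \<in> multipliers A" "T \<in> multipliers A" by simp_all
    then show "factor_multiplier A (p \<alpha>) (S \<ominus>\<^bsub>multiplier_algebra A\<^esub> T) =
        factor_multiplier A (p \<alpha>) S \<ominus>\<^bsub>multiplier_algebra (fac \<alpha>)\<^esub> factor_multiplier A (p \<alpha>) T"
      using \<alpha> by (rule factor_multiplier_minus[rotated])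
  qed (use \<alpha> factor_multiplier in simp)
  then show "continuous_map (multiplier_topology A \<Lambda> p) (opnorm_topology \<alpha>) (\<lambda>T. to_limit T \<alpha>)"
    using \<alpha> by (simp add: to_limit_def)
qed (use to_limit_closed in \<open>auto simp: topspace_multiplier_topology to_limit_def\<close>)

text \<open>Each coordinate preserves the seminorm of differences, so the preimage under
  \<open>g\<close> of a generating ball around T is the preimage under one coordinate projection of
  the ball around the multiplier induced by T.\<close>

lemma to_limit_inverse_continuous:
  assumes inv: "\<And>u. u \<in> carrier L \<Longrightarrow> g u \<in> multipliers A \<and> to_limit (g u) = u"
  shows "continuous_map (limit_multiplier_topology A \<Lambda> p) (multiplier_topology A \<Lambda> p) g"
proof -
  let ?X = "limit_multiplier_topology A \<Lambda> p"
  have ball: "openin ?X {u \<in> carrier L. multiplier_seminorm A (p \<alpha>) (g u \<ominus>\<^bsub>multiplier_algebra A\<^esub> T) < e}"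
    if \<alpha>: "\<alpha> \<in> \<Lambda>" and T: "T \<in> multipliers A" and e: "0 < e" for \<alpha> T e
  proof -
    let ?B = "{V \<in> multipliers (fac \<alpha>). factor_opnorm A (p \<alpha>)
      (V \<ominus>\<^bsub>multiplier_algebra (fac \<alpha>)\<^esub> factor_multiplier A (p \<alpha>) T) < e}"
    have "openin (opnorm_topology \<alpha>) ?B"
      using group_seminorms.openin_ball[OF group_seminorms_opnorm[OF \<alpha>], of _ "factor_multiplier A (p \<alpha>) T" e]
        factor_multiplier[OF \<alpha> T] e by simp
    moreover have "continuous_map ?X (opnorm_topology \<alpha>) (\<lambda>u. u \<alpha>)"
      unfolding limit_multiplier_topology_def
      using \<alpha> by (intro continuous_map_from_subtopology continuous_map_product_projection)
    ultimately have "openin ?X {u \<in> carrier L. u \<alpha> \<in> ?B}"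
      unfolding topspace_limit_topology[symmetric] by (rule openin_continuous_map_preimage[rotated])
    moreover have "multiplier_seminorm A (p \<alpha>) (g u \<ominus>\<^bsub>multiplier_algebra A\<^esub> T) < e \<longleftrightarrow> u \<alpha> \<in> ?B"
      if u: "u \<in> carrier L" for u
    proof -
      have "u \<alpha> = factor_multiplier A (p \<alpha>) (g u)"
        using inv[OF u] \<alpha> by (metis restrict_apply' to_limit_def)
      then show ?thesis
        using factor_multiplier_minus[OF \<alpha> _ T] factor_multiplier[OF \<alpha>] inv[OF u]
        by (simp add: multiplier_seminorm_def)
    qed
    ultimately show ?thesis by (simp cong: conj_cong)
  qed
  have "openin ?X (g -` U \<inter> topspace ?X)"
    if U: "U \<in> {{S \<in> carrier (multiplier_algebra A). q (S \<ominus>\<^bsub>multiplier_algebra A\<^esub> T) < e} | q T e.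
      q \<in> (\<lambda>\<alpha>. multiplier_seminorm A (p \<alpha>)) ` \<Lambda> \<and> T \<in> carrier (multiplier_algebra A) \<and> 0 < e}" for U
  proof -
    obtain \<alpha> T e where \<alpha>: "\<alpha> \<in> \<Lambda>" and T: "T \<in> carrier (multiplier_algebra A)" and e: "0 < e"
      and U: "U = {S \<in> carrier (multiplier_algebra A).
        multiplier_seminorm A (p \<alpha>) (S \<ominus>\<^bsub>multiplier_algebra A\<^esub> T) < e}"
      using U by blast
    have "T \<in> multipliers A" using T by simp
    note ball[OF \<alpha> this e]
    also have "{u \<in> carrier L. multiplier_seminorm A (p \<alpha>) (g u \<ominus>\<^bsub>multiplier_algebra A\<^esub> T) < e} =
        g -` U \<inter> topspace ?X"
      using inv by (auto simp: U topspace_limit_topology)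
    finally show ?thesis .
  qed
  moreover have "g ` topspace ?X \<subseteq> topspace (multiplier_topology A \<Lambda> p)"
    using inv by (auto simp: topspace_limit_topology topspace_multiplier_topology)
  ultimately show ?thesis
    unfolding multiplier_topology_def seminorm_topology_def[of "multiplier_algebra A"]
      continuous_on_generated_topo_iff topology_generated_by_topspace by blast
qed

lemma to_limit_homeomorphic:
  assumes "complete_algebra A \<tau>"
  shows "homeomorphic_map (multiplier_topology A \<Lambda> p) (limit_multiplier_topology A \<Lambda> p) to_limit"
  unfolding homeomorphic_map_maps homeomorphic_maps_def
proof (intro exI conjI ballI)
  let ?g = "inv_into (multipliers A) to_limit"
  show "continuous_map (limit_multiplier_topology A \<Lambda> p) (multiplier_topology A \<Lambda> p) ?g"
    using to_limit_surj[OF assms]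
    by (intro to_limit_inverse_continuous) (simp add: inv_into_into f_inv_into_f)
  show "?g (to_limit T) = T" if "T \<in> topspace (multiplier_topology A \<Lambda> p)" for T
    using that to_limit_inj by (simp add: topspace_multiplier_topology)
  show "to_limit (?g u) = u" if "u \<in> topspace (limit_multiplier_topology A \<Lambda> p)" for u
    using that to_limit_surj[OF assms] by (simp add: topspace_limit_topology f_inv_into_f)
qed (rule to_limit_continuous)

end

end

theorem theorem2p9:
  fixes E :: "(complex, 'a) module" and \<tau> :: "'a topology"
    and \<Lambda> :: "'i set" and p :: "'i \<Rightarrow> 'a \<Rightarrow> real"
  assumes "uniform_topological_algebra E \<tau> \<Lambda> p"
    and "complete_algebra E \<tau>"
  shows "\<exists>\<phi>\<in>algebra_iso (multiplier_algebra E) (limit_multiplier_algebra E \<Lambda> p).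
    (\<forall>\<alpha>\<in>\<Lambda>. complete_algebra (factor_algebra E (p \<alpha>))
        (seminorm_topology (factor_algebra E (p \<alpha>)) {factor_norm (p \<alpha>)})) \<longrightarrow>
      (\<forall>T\<in>multipliers E. continuous_map \<tau> \<tau> T) \<and>
      homeomorphic_map (multiplier_topology E \<Lambda> p) (limit_multiplier_topology E \<Lambda> p) \<phi>"
proof -
  interpret uniform_topological_algebra E \<tau> \<Lambda> p by fact
  show ?thesis
    \<comment> \<open>The one witness \<open>to_limit\<close> is fixed before completeness of the
      factors is assumed, and is a homeomorphism under that assumption.\<close>
    using to_limit_iso[OF assms(2)] multiplier_continuous to_limit_homeomorphic[OF _ assms(2)]
    by (intro bexI[of _ to_limit]) blast+
qed

end
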